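(* Let $0\le M<1/2$ and let $U$ be a $2\times2$ unitary matrix. The self-adjoint boundary condition labelled by $U$ is $\widetilde{\mathrm{SL}}(2,\mathbb{R})$-invariant (in the sense defined in the context) if and only if: (i) in the case $M=0$: $U$ is diagonal; (ii) in the case $0<M<1/2$: $U$ is one of the four matrices $\mathrm{diag}(-1,1)$, $\mathrm{diag}(1,-1)$, $\mathbb{I}$, $-\mathbb{I}$. These four matrices correspond, respectively, to the boundary conditions - type I: $\widetilde{\Phi^{(2)}}(\pi/2)=0=\widetilde{\Phi^{(1)}}(-\pi/2)$; - type II: $\widetilde{\Phi^{(1)}}(\pi/2)=0=\widetilde{\Phi^{(2)}}(-\pi/2)$; - type III: $\widetilde{\Phi^{(1)}}(\pi/2)=0=\widetilde{\Phi^{(1)}}(-\pi/2)$; - type IV: $\widetilde{\Phi^{(2)}}(\pi/2)=0=\widetilde{\Phi^{(2)}}(-\pi/2)$.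
   Context: Let $\sigma(\rho)=\left(\frac{1-\sin\rho}{1+\sin\rho}\right)^{1/2}$ on $(-\pi/2,\pi/2)$. For a $\mathbb{C}^2$-valued function $\Phi=(\Phi^{(1)},\Phi^{(2)})^T$ put $\widetilde{\Phi^{(1)}}=\sigma^{-M}\Phi^{(1)}$, $\widetilde{\Phi^{(2)}}=\sigma^{M}\Phi^{(2)}$, with values at $\pm\pi/2$ understood as limits. The boundary condition labelled by the unitary matrix $U$ is $$(\mathbb{I}-U)\begin{pmatrix}\widetilde{\Phi^{(2)}}(\pi/2)\\ \widetilde{\Phi^{(2)}}(-\pi/2)\end{pmatrix}=i(\mathbb{I}+U)\begin{pmatrix}\widetilde{\Phi^{(1)}}(\pi/2)\\ -\widetilde{\Phi^{(1)}}(-\pi/2)\end{pmatrix}.\qquad (\mathrm{BC}_U)$$ These are exactly the boundary conditions defining the self-adjoint extensions of the operator $\mathbb{D}=\begin{pmatrix}0&-\frac{d}{d\rho}+M\sec\rho\\ \frac{d}{d\rho}+M\sec\rho&0\end{pmatrix}$, initially defined on $C_c^\infty((-\pi/2,\pi/2),\mathbb{C}^2)\subset L^2((-\pi/2,\pi/2),\mathbb{C}^2)$. For $\omega\in\mathbb{R}$ and a solution $\Phi_\omega$ of the differential equation $\mathbb{D}\Phi_\omega=\omega\Phi_\omega$ on $(-\pi/2,\pi/2)$, the infinitesimal $\widetilde{\mathrm{SL}}(2,\mathbb{R})$ action (the ladder operators, up to constant factors and time dependence) is $$\delta_\pm\Phi_\omega=\Big[\cos\rho\,\tfrac{d}{d\rho}-\big(\tfrac12\pm\omega\big)\sin\rho\mp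 i\cos\rho\,\Sigma^{01}\Big]\Phi_\omega,\qquad \Sigma^{01}=\tfrac12\begin{pmatrix}0&i\\-i&0\end{pmatrix}.$$ The condition $(\mathrm{BC}_U)$ is called $\widetilde{\mathrm{SL}}(2,\mathbb{R})$-invariant if for every $\omega\in\mathbb{R}$ and every solution $\Phi_\omega$ of $\mathbb{D}\Phi_\omega=\omega\Phi_\omega$ satisfying $(\mathrm{BC}_U)$, both $\delta_+\Phi_\omega$ and $\delta_-\Phi_\omega$ also satisfy $(\mathrm{BC}_U)$. *)

theory Defs
  imports "HOL-Analysis.Analysis"
begin

definition hermitian_adjoint :: "complex^'n^'m \<Rightarrow> complex^'m^'n" where
  "hermitian_adjoint A = (\<chi> i j. cnj (A $ j $ i))"

definition unitary_matrix :: "complex^'n^'n \<Rightarrow> bool" where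
  "unitary_matrix U \<longleftrightarrow>
     hermitian_adjoint U ** U = mat 1 \<and> U ** hermitian_adjoint U = mat 1"

definition diagonal_matrix :: "complex^'n^'n \<Rightarrow> bool" where
  "diagonal_matrix U \<longleftrightarrow> (\<forall>i j. i \<noteq> j \<longrightarrow> U $ i $ j = 0)"

definition diag2 :: "complex \<Rightarrow> complex \<Rightarrow> complex^2^2" where
  "diag2 a b = vector [vector [a, 0], vector [0, b]]"

definition sigma_fn :: "real \<Rightarrow> real" where
  "sigma_fn \<rho> = sqrt ((1 - sin \<rho>) / (1 + sin \<rho>))"

definition tilde1 :: "real \<Rightarrow> (real \<Rightarrow> complex^2) \<Rightarrow> real \<Rightarrow> complex" where
  "tilde1 M \<Phi> \<rho> = (sigma_fn \<rho> powr (- M)) *\<^sub>R (\<Phi> \<rho> $ 1)"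

definition tilde2 :: "real \<Rightarrow> (real \<Rightarrow> complex^2) \<Rightarrow> real \<Rightarrow> complex" where
  "tilde2 M \<Phi> \<rho> = (sigma_fn \<rho> powr M) *\<^sub>R (\<Phi> \<rho> $ 2)"

definition right_value :: "(real \<Rightarrow> complex) \<Rightarrow> complex" where
  "right_value f = Lim (at_left (pi / 2)) f"

definition left_value :: "(real \<Rightarrow> complex) \<Rightarrow> complex" where
  "left_value f = Lim (at_right (- (pi / 2))) f"

(* Lim is a definite description and means nothing when the limit does not exist, so
   existence of the four limits is a separate condition. *)
definition has_boundary_values :: "real \<Rightarrow> (real \<Rightarrow> complex^2) \<Rightarrow> bool" where
  "has_boundary_values M \<Phi> \<longleftrightarrow>
     (\<exists>l. (tilde1 M \<Phi> \<longlongrightarrow> l) (at_left (pi / 2))) \<and>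
     (\<exists>l. (tilde1 M \<Phi> \<longlongrightarrow> l) (at_right (- (pi / 2)))) \<and>
     (\<exists>l. (tilde2 M \<Phi> \<longlongrightarrow> l) (at_left (pi / 2))) \<and>
     (\<exists>l. (tilde2 M \<Phi> \<longlongrightarrow> l) (at_right (- (pi / 2))))"

definition satisfies_BC :: "real \<Rightarrow> complex^2^2 \<Rightarrow> (real \<Rightarrow> complex^2) \<Rightarrow> bool" where
  "satisfies_BC M U \<Phi> \<longleftrightarrow>
     has_boundary_values M \<Phi> \<and>
     (mat 1 - U) *v vector [right_value (tilde2 M \<Phi>), left_value (tilde2 M \<Phi>)] =
     \<i> *s ((mat 1 + U) *v vector [right_value (tilde1 M \<Phi>), - left_value (tilde1 M \<Phi>)])"

definition dirac_op :: "real \<Rightarrow> (real \<Rightarrow> complex^2) \<Rightarrow> real \<Rightarrow> complex^2" where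
  "dirac_op M \<Phi> \<rho> = vector
     [- (vector_derivative \<Phi> (at \<rho>) $ 2) + (M / cos \<rho>) *\<^sub>R (\<Phi> \<rho> $ 2),
      vector_derivative \<Phi> (at \<rho>) $ 1 + (M / cos \<rho>) *\<^sub>R (\<Phi> \<rho> $ 1)]"

definition is_solution :: "real \<Rightarrow> real \<Rightarrow> (real \<Rightarrow> complex^2) \<Rightarrow> bool" where
  "is_solution M \<omega> \<Phi> \<longleftrightarrow>
     (\<forall>\<rho>\<in>{- (pi / 2)<..<pi / 2}.
        \<Phi> differentiable at \<rho> \<and> dirac_op M \<Phi> \<rho> = \<omega> *\<^sub>R \<Phi> \<rho>)"

definition Sigma01 :: "complex^2^2" where
  "Sigma01 = vector [vector [0, \<i> / 2], vector [- \<i> / 2, 0]]"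

definition delta_plus :: "real \<Rightarrow> (real \<Rightarrow> complex^2) \<Rightarrow> real \<Rightarrow> complex^2" where
  "delta_plus \<omega> \<Phi> \<rho> =
     cos \<rho> *\<^sub>R vector_derivative \<Phi> (at \<rho>) - ((1/2 + \<omega>) * sin \<rho>) *\<^sub>R \<Phi> \<rho>
     - (\<i> * of_real (cos \<rho>)) *s (Sigma01 *v \<Phi> \<rho>)"

definition delta_minus :: "real \<Rightarrow> (real \<Rightarrow> complex^2) \<Rightarrow> real \<Rightarrow> complex^2" where
  "delta_minus \<omega> \<Phi> \<rho> =
     cos \<rho> *\<^sub>R vector_derivative \<Phi> (at \<rho>) - ((1/2 - \<omega>) * sin \<rho>) *\<^sub>R \<Phi> \<rho>
     + (\<i> * of_real (cos \<rho>)) *s (Sigma01 *v \<Phi> \<rho>)"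

definition SL2_invariant :: "real \<Rightarrow> complex^2^2 \<Rightarrow> bool" where
  "SL2_invariant M U \<longleftrightarrow>
     (\<forall>\<omega> \<Phi>. is_solution M \<omega> \<Phi> \<and> satisfies_BC M U \<Phi> \<longrightarrow>
        satisfies_BC M U (delta_plus \<omega> \<Phi>) \<and> satisfies_BC M U (delta_minus \<omega> \<Phi>))"

definition bc_type_I :: "real \<Rightarrow> (real \<Rightarrow> complex^2) \<Rightarrow> bool" where
  "bc_type_I M \<Phi> \<longleftrightarrow> right_value (tilde2 M \<Phi>) = 0 \<and> left_value (tilde1 M \<Phi>) = 0"

definition bc_type_II :: "real \<Rightarrow> (real \<Rightarrow> complex^2) \<Rightarrow> bool" where
  "bc_type_II M \<Phi> \<longleftrightarrow> right_value (tilde1 M \<Phi>) = 0 \<and> left_value (tilde2 M \<Phi>) = 0"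

definition bc_type_III :: "real \<Rightarrow> (real \<Rightarrow> complex^2) \<Rightarrow> bool" where
  "bc_type_III M \<Phi> \<longleftrightarrow> right_value (tilde1 M \<Phi>) = 0 \<and> left_value (tilde1 M \<Phi>) = 0"

definition bc_type_IV :: "real \<Rightarrow> (real \<Rightarrow> complex^2) \<Rightarrow> bool" where
  "bc_type_IV M \<Phi> \<longleftrightarrow> right_value (tilde2 M \<Phi>) = 0 \<and> left_value (tilde2 M \<Phi>) = 0"

end

(* In the variables f = sigma^(-M) Phi1, g = sigma^M Phi2 the equation D Phi = omega Phi becomes
   f' = omega p g, g' = -omega f / p with p = sigma^(-2M), which is integrable because M < 1/2.
   A change of the independent variable makes this a planar linear system with continuous
   coefficients on [0,1], so all boundary values exist, and on them delta_+- acts diagonally.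
   If f + i g solves the system, its argument decreases, by an amount which tends to infinity
   with omega.  The boundary condition BC_U has a nonzero solution exactly when a certain linear
   function of the transfer matrix takes a certain real value; the winding makes it take that
   value for some omega >= 1.  Comparing the boundary condition for this one eigenfunction with
   the boundary conditions for its two ladder images forces U to be diagonal and, if M > 0,
   to have diagonal entries +-1. *)

theory Submission
  imports Defs
begin

text \<open>When M > 0 one of p and 1/p blows up at each end, like delta^(-2M) at distance delta, so
  the system in f and g is singular there. The new variable has derivative of order delta^(-(M +
  1/2)); the exponent M + 1/2 is the mean of 2M and 1, so it exceeds the blow-up and stays
  integrable exactly when M < 1/2. The real system preserves the Wronskian, so its transfer matrix T
  has determinant 1. For unitary U the solvability condition becomes, up to a phase, trace (N T) = 2
  beta with N and beta real. The turning of the argument only guarantees trace values at or beyond 2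
  sqrt (det N) and -2 sqrt (det N); unitarity supplies beta^2 <= det N, which puts the target
  between them. One eigenfunction is enough because its two boundary values at either end never
  vanish together, and the ladder operators multiply the four values by scalars that are affine in
  omega and M. The eigenvalue has to be nonzero so that the difference of the two ladder conditions
  can be divided by it.\<close>

section \<open>Linear differential equations depending on a parameter\<close>

text \<open>The coefficients of the expansion in powers of \<open>w\<close> of the solution of \<open>X' = w A X\<close>, \<open>X 0 = x\<close>.\<close>

primrec ode_coeff :: "(real \<Rightarrow> 'a \<Rightarrow>\<^sub>L 'a) \<Rightarrow> 'a::banach \<Rightarrow> nat \<Rightarrow> real \<Rightarrow> 'a" where
  "ode_coeff A x 0 = (\<lambda>t. x)"
| "ode_coeff A x (Suc k) = (\<lambda>t. integral {0..t} (\<lambda>s. blinfun_apply (A s) (ode_coeff A x k s)))"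

lemma continuous_ode_coeff:
  assumes "continuous_on {0..1} A"
  shows "continuous_on {0..1} (ode_coeff A x k)"
proof (induction k)
  case (Suc k)
  have "continuous_on {0..1} (\<lambda>s. blinfun_apply (A s) (ode_coeff A x k s))"
    by (intro continuous_intros assms Suc)
  then show ?case
    by (simp add: indefinite_integral_continuous_1 integrable_continuous_real)
qed (simp add: continuous_on_const)

text \<open>A k-fold iterated integral runs over a simplex of volume t^k / k!. The factorial is what
  makes the series converge uniformly on every bounded range of \<open>w\<close>.\<close>

lemma norm_ode_coeff_le:
  assumes A: "continuous_on {0..1} A" and C: "\<And>t. t \<in> {0..1} \<Longrightarrow> norm (A t) \<le> C"
    and t: "t \<in> {0..1}"
  shows "norm (ode_coeff A x k t) \<le> norm x * (C * t) ^ k / fact k"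
  using t
proof (induction k arbitrary: t)
  case (Suc k)
  have C0: "0 \<le> C" using order_trans[OF norm_ge_zero C[of 0]] by simp
  let ?c = "norm x * C ^ Suc k / fact k"
  have pow: "((\<lambda>s. ?c * s ^ k) has_integral ?c * (t ^ Suc k / real (Suc k))) {0..t}"
  proof -
    have "((\<lambda>s. s ^ k) has_integral t ^ Suc k / real (Suc k) - 0 ^ Suc k / real (Suc k)) {0..t}"
      using Suc.prems
      by (intro fundamental_theorem_of_calculus)
         (auto intro!: derivative_eq_intros simp flip: has_real_derivative_iff_has_vector_derivative
            simp del: power_Suc)
    then show ?thesis by (intro has_integral_mult_right) simp
  qed
  have "continuous_on {0..t} (\<lambda>s. blinfun_apply (A s) (ode_coeff A x k s))"
    using Suc.prems
    by (intro continuous_intros continuous_on_subset[OF A]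
          continuous_on_subset[OF continuous_ode_coeff[OF A]]) auto
  then have "norm (integral {0..t} (\<lambda>s. blinfun_apply (A s) (ode_coeff A x k s)))
      \<le> integral {0..t} (\<lambda>s. ?c * s ^ k)"
  proof (intro integral_norm_bound_integral integrable_continuous_real)
    fix s assume s: "s \<in> {0..t}"
    have "norm (blinfun_apply (A s) (ode_coeff A x k s)) \<le> norm (A s) * norm (ode_coeff A x k s)"
      by (rule norm_blinfun)
    also have "\<dots> \<le> C * (norm x * (C * s) ^ k / fact k)"
      using s Suc.prems C0 by (intro mult_mono C Suc.IH) auto
    also have "\<dots> = ?c * s ^ k" by (simp add: power_mult_distrib)
    finally show "norm (blinfun_apply (A s) (ode_coeff A x k s)) \<le> ?c * s ^ k" .
  qed (auto intro!: continuous_intros)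
  also have "\<dots> = ?c * (t ^ Suc k / real (Suc k))"
    using pow by (rule integral_unique)
  also have "\<dots> = norm x * (C * t) ^ Suc k / fact (Suc k)"
    by (simp add: power_mult_distrib divide_simps)
  finally show ?case by simp
qed simp

lemma uniform_limit_ode_series:
  assumes A: "continuous_on {0..1} A"
  shows "uniform_limit ({-R..R} \<times> {0..1})
      (\<lambda>n (w, t). \<Sum>k<n. w ^ k *\<^sub>R ode_coeff A x k t)
      (\<lambda>(w, t). \<Sum>k. w ^ k *\<^sub>R ode_coeff A x k t) sequentially"
proof -
  have "bounded (A ` {0..1})"
    by (intro compact_imp_bounded compact_continuous_image A) simp
  then obtain C where C: "\<And>t. t \<in> {0..1} \<Longrightarrow> norm (A t) \<le> C"
    unfolding bounded_iff by blast
  have C0: "0 \<le> C" using order_trans[OF norm_ge_zero C[of 0]] by simp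
  have "uniform_limit ({-R..R} \<times> {0..1})
      (\<lambda>n p. \<Sum>k<n. fst p ^ k *\<^sub>R ode_coeff A x k (snd p))
      (\<lambda>p. \<Sum>k. fst p ^ k *\<^sub>R ode_coeff A x k (snd p)) sequentially"
  proof (rule Weierstrass_m_test)
    show "summable (\<lambda>k. norm x * ((\<bar>R\<bar> * C) ^ k / fact k))"
      using summable_exp_generic[of "\<bar>R\<bar> * C"]
      by (intro summable_mult) (simp add: field_simps)
    fix k and p :: "real \<times> real" assume "p \<in> {-R..R} \<times> {0..1}"
    then obtain w t where p: "p = (w, t)" "\<bar>w\<bar> \<le> \<bar>R\<bar>" "t \<in> {0..1}"
      by (auto simp: abs_if split: if_splits)
    have "norm (w ^ k *\<^sub>R ode_coeff A x k t) = \<bar>w\<bar> ^ k * norm (ode_coeff A x k t)"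
      by (simp add: power_abs)
    also have "\<dots> \<le> \<bar>R\<bar> ^ k * (norm x * (C * 1) ^ k / fact k)"
    proof (intro mult_mono power_mono p)
      have "norm (ode_coeff A x k t) \<le> norm x * (C * t) ^ k / fact k"
        using norm_ode_coeff_le[OF A C p(3)] by blast
      also have "\<dots> \<le> norm x * (C * 1) ^ k / fact k"
        using p C0 by (intro divide_right_mono mult_left_mono power_mono) auto
      finally show "norm (ode_coeff A x k t) \<le> norm x * (C * 1) ^ k / fact k" .
    qed auto
    finally show "norm (fst p ^ k *\<^sub>R ode_coeff A x k (snd p))
        \<le> norm x * ((\<bar>R\<bar> * C) ^ k / fact k)"
      by (simp add: p power_mult_distrib mult_ac)
  qed
  then show ?thesis by (simp add: case_prod_unfold)
qed

text \<open>Existence for each \<open>w\<close> is not enough: continuity jointly in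
  \<open>w\<close> and \<open>t\<close> feeds the intermediate value theorem in \<open>w\<close>.
  The power series provides it by uniform convergence, and the integral equation survives the same
  limit.\<close>

lemma linear_ode_family:
  fixes A :: "real \<Rightarrow> 'a::banach \<Rightarrow>\<^sub>L 'a" and x :: 'a
  assumes A: "continuous_on {0..1} A"
  obtains X :: "real \<Rightarrow> real \<Rightarrow> 'a" where
    "\<And>R. continuous_on ({-R..R} \<times> {0..1}) (\<lambda>(w, t). X w t)"
    "\<And>w. X w 0 = x"
    "\<And>w t. t \<in> {0..1} \<Longrightarrow>
       (X w has_vector_derivative w *\<^sub>R blinfun_apply (A t) (X w t)) (at t within {0..1})"
proof -
  define S where "S n w t = (\<Sum>k<n. w ^ k *\<^sub>R ode_coeff A x k t)" for n and w t :: real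
  define X where "X w t = (\<Sum>k. w ^ k *\<^sub>R ode_coeff A x k t)" for w t :: real
  have unif: "uniform_limit ({-R..R} \<times> {0..1}) (\<lambda>n (w, t). S n w t) (\<lambda>(w, t). X w t) sequentially" for R
    unfolding S_def X_def using uniform_limit_ode_series[OF A] .
  have contS: "continuous_on ({-R..R} \<times> {0..1}) (\<lambda>(w, t). S n w t)" for R n
    unfolding S_def case_prod_unfold
    by (intro continuous_intros continuous_on_compose2[OF continuous_ode_coeff[OF A]]) auto
  have contX: "continuous_on ({-R..R} \<times> {0..1}) (\<lambda>(w, t). X w t)" for R
    by (rule uniform_limit_theorem[OF always_eventually[OF allI[OF contS]] unif]) simp
  have X0: "X w 0 = x" for w
  proof -
    have "w ^ k *\<^sub>R ode_coeff A x k 0 = (if k = 0 then x else 0)" for k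
      by (cases k) auto
    then show ?thesis unfolding X_def using sums_unique[OF sums_single[of 0 "\<lambda>_. x"]] by simp
  qed
  have ptS: "continuous_on {0..1} (S n w)" for n w
    unfolding S_def by (intro continuous_intros continuous_ode_coeff A)
  have ptX: "continuous_on {0..1} (X w)" for w
    using continuous_on_compose2[OF contX[of "\<bar>w\<bar>"], of "{0..1}" "\<lambda>t. (w, t)"]
    by (force intro!: continuous_intros)
  have unif_w: "uniform_limit {0..1} (\<lambda>n t. S n w t) (X w) sequentially" for w
    using uniform_limit_compose'[OF unif[of "\<bar>w\<bar>"], of "\<lambda>t. (w, t)" "{0..1}"] by force
  have int_eq: "X w t = x + integral {0..t} (\<lambda>s. w *\<^sub>R blinfun_apply (A s) (X w s))"
    if t: "t \<in> {0..1}" for w t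
  proof -
    have sub: "{0..t} \<subseteq> {0..1}" using t by auto
    have ul: "uniform_limit {0..t} (\<lambda>n s. w *\<^sub>R blinfun_apply (A s) (S n w s))
        (\<lambda>s. w *\<^sub>R blinfun_apply (A s) (X w s)) sequentially"
    proof -
      have bd: "bounded (A ` {0..t})" "bounded (X w ` {0..t})"
        using compact_continuous_image[OF continuous_on_subset[OF A sub]]
          compact_continuous_image[OF continuous_on_subset[OF ptX sub]]
        by (auto intro: compact_imp_bounded)
      have "uniform_limit {0..t} (\<lambda>n s. blinfun_apply (A s) (S n w s))
        (\<lambda>s. blinfun_apply (A s) (X w s)) sequentially"
        by (intro bounded_bilinear.bounded_uniform_limit[OF bounded_bilinear_blinfun_apply]
            uniform_limit_const uniform_limit_on_subset[OF unif_w sub] bd)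
      then show ?thesis
        by (rule bounded_linear.uniform_limit[OF bounded_linear_scaleR_right])
    qed
    have cont: "continuous_on {0..t} (\<lambda>s. w *\<^sub>R blinfun_apply (A s) (S n w s))" for n
      by (intro continuous_intros continuous_on_subset[OF A sub] continuous_on_subset[OF ptS sub])
    obtain I J where I: "\<And>n. ((\<lambda>s. w *\<^sub>R blinfun_apply (A s) (S n w s)) has_integral I n) {0..t}"
      and J: "((\<lambda>s. w *\<^sub>R blinfun_apply (A s) (X w s)) has_integral J) {0..t}"
      and IJ: "I \<longlonglongrightarrow> J"
      using uniform_limit_integral[OF ul cont sequentially_bot] by blast
    \<comment> \<open>Picard iteration: integrating the terms of index below \<open>n\<close>
      reproduces those of index 1 to \<open>n\<close>, hence the shift to
      \<open>Suc n\<close>.\<close>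
    have "S (Suc n) w t = x + I n" for n
    proof -
      have "((\<lambda>s. w *\<^sub>R blinfun_apply (A s) (S n w s)) has_integral
          (\<Sum>k<n. w ^ Suc k *\<^sub>R ode_coeff A x (Suc k) t)) {0..t}"
      proof -
        have "((\<lambda>s. \<Sum>k<n. w ^ Suc k *\<^sub>R blinfun_apply (A s) (ode_coeff A x k s)) has_integral
          (\<Sum>k<n. w ^ Suc k *\<^sub>R ode_coeff A x (Suc k) t)) {0..t}"
        proof (intro has_integral_sum has_integral_cmul finite_lessThan)
          fix k
          have "continuous_on {0..t} (\<lambda>s. blinfun_apply (A s) (ode_coeff A x k s))"
            by (intro continuous_intros continuous_on_subset[OF A sub]
                continuous_on_subset[OF continuous_ode_coeff[OF A] sub])
          then show "((\<lambda>s. blinfun_apply (A s) (ode_coeff A x k s)) has_integral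
              ode_coeff A x (Suc k) t) {0..t}"
            by (simp add: integrable_continuous_real integrable_integral)
        qed
        moreover have "(\<lambda>s. \<Sum>k<n. w ^ Suc k *\<^sub>R blinfun_apply (A s) (ode_coeff A x k s))
           = (\<lambda>s. w *\<^sub>R blinfun_apply (A s) (S n w s))"
          by (simp add: S_def blinfun.sum_right blinfun.scaleR_right scaleR_right.sum)
        ultimately show ?thesis by simp
      qed
      with I have "I n = (\<Sum>k<n. w ^ Suc k *\<^sub>R ode_coeff A x (Suc k) t)"
        by (rule has_integral_unique)
      then show ?thesis unfolding S_def sum.lessThan_Suc_shift by simp
    qed
    then have "(\<lambda>n. S (Suc n) w t) \<longlonglongrightarrow> x + J"
      using IJ by (simp add: tendsto_add)
    moreover have "(\<lambda>n. S (Suc n) w t) \<longlonglongrightarrow> X w t"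
      using tendsto_uniform_limitI[OF unif_w t] by (rule LIMSEQ_Suc)
    ultimately have "X w t = x + J" by (rule LIMSEQ_unique[symmetric])
    then show ?thesis by (simp only: integral_unique[OF J])
  qed
  have "(X w has_vector_derivative w *\<^sub>R blinfun_apply (A t) (X w t)) (at t within {0..1})"
    if t: "t \<in> {0..1}" for w t
  proof -
    have "((\<lambda>t. integral {0..t} (\<lambda>s. w *\<^sub>R blinfun_apply (A s) (X w s)))
        has_vector_derivative w *\<^sub>R blinfun_apply (A t) (X w t)) (at t within {0..1})"
      by (intro integral_has_vector_derivative t continuous_intros A ptX)
    then have "((\<lambda>t. x + integral {0..t} (\<lambda>s. w *\<^sub>R blinfun_apply (A s) (X w s)))
        has_vector_derivative w *\<^sub>R blinfun_apply (A t) (X w t)) (at t within {0..1})"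
      by (rule has_vector_derivative_eq_rhs[OF has_vector_derivative_add[OF has_vector_derivative_const]]) simp
    then show ?thesis
      by (rule has_vector_derivative_transform[OF t, rotated]) (simp add: int_eq)
  qed
  with contX X0 show thesis by (rule that)
qed

section \<open>Winding of solutions of a planar system\<close>

text \<open>The coefficients of interest vanish at both ends of the interval, so only nonnegativity
  is available throughout. Positivity at one interior point, with continuity, still forces a
  definite rotation.\<close>

locale planar_system =
  fixes u v :: "real \<Rightarrow> real"
  assumes continuous_u: "continuous_on {0..1} u" and continuous_v: "continuous_on {0..1} v"
    and u_nonneg: "\<And>t. t \<in> {0..1} \<Longrightarrow> 0 \<le> u t" and v_nonneg: "\<And>t. t \<in> {0..1} \<Longrightarrow> 0 \<le> v t"
    and u_pos: "0 < u (1/2)" and v_pos: "0 < v (1/2)"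
begin

text \<open>The plane is written as the complex line so that angles become imaginary parts of
  logarithms; the map itself is in general only real-linear.\<close>

definition vector_field :: "real \<Rightarrow> complex \<Rightarrow> complex" where
  "vector_field t z = Complex (u t * Im z) (- (v t * Re z))"

definition solution :: "real \<Rightarrow> (real \<Rightarrow> complex) \<Rightarrow> bool" where
  "solution w X \<longleftrightarrow>
     (\<forall>t\<in>{0..1}. (X has_vector_derivative w *\<^sub>R vector_field t (X t)) (at t within {0..1}))"

lemma solution_continuous: "solution w X \<Longrightarrow> continuous_on {0..1} X"
  unfolding solution_def continuous_on_eq_continuous_within
  by (blast intro: has_vector_derivative_continuous)

lemma solution_family:
  obtains X where
    "\<And>R. continuous_on ({-R..R} \<times> {0..1}) (\<lambda>(w, t). X w t)"
    "\<And>w. X w 0 = x" "\<And>w. solution w (X w)"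
proof -
  define P where "P = Blinfun (\<lambda>z. complex_of_real (Im z))"
  define Q where "Q = Blinfun (\<lambda>z. - (\<i> * complex_of_real (Re z)))"
  have "bounded_linear (\<lambda>z. complex_of_real (Im z))"
    by (intro bounded_linear_compose[OF bounded_linear_of_real] bounded_linear_Im)
  then have P: "blinfun_apply P z = complex_of_real (Im z)" for z
    unfolding P_def by (simp add: bounded_linear_Blinfun_apply)
  have "bounded_linear (\<lambda>z. - (\<i> * complex_of_real (Re z)))"
    by (intro bounded_linear_minus bounded_linear_compose[OF bounded_linear_mult_right]
        bounded_linear_compose[OF bounded_linear_of_real] bounded_linear_Re)
  then have Q: "blinfun_apply Q z = - (\<i> * complex_of_real (Re z))" for z
    unfolding Q_def by (simp add: bounded_linear_Blinfun_apply)
  define A where "A t = u t *\<^sub>R P + v t *\<^sub>R Q" for t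
  have "continuous_on {0..1} A"
    unfolding A_def by (intro continuous_intros continuous_u continuous_v)
  moreover have "blinfun_apply (A t) z = vector_field t z" for t z
    by (simp add: A_def vector_field_def blinfun.add_left blinfun.scaleR_left P Q complex_eq_iff)
  ultimately show thesis
    using linear_ode_family[of A x] that unfolding solution_def by metis
qed

lemma solution_lincomb:
  assumes "solution w X" "solution w Y"
  shows "solution w (\<lambda>t. a *\<^sub>R X t + b *\<^sub>R Y t)"
  unfolding solution_def
proof
  fix t :: real assume "t \<in> {0..1}"
  then have "((\<lambda>t. a *\<^sub>R X t + b *\<^sub>R Y t) has_vector_derivative
      a *\<^sub>R (w *\<^sub>R vector_field t (X t)) + b *\<^sub>R (w *\<^sub>R vector_field t (Y t))) (at t within {0..1})"
    using assms unfolding solution_def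
    by (intro has_vector_derivative_add bounded_linear.has_vector_derivative[OF bounded_linear_scaleR_right]) auto
  moreover have "a *\<^sub>R (w *\<^sub>R vector_field t (X t)) + b *\<^sub>R (w *\<^sub>R vector_field t (Y t))
      = w *\<^sub>R vector_field t (a *\<^sub>R X t + b *\<^sub>R Y t)"
    by (simp add: vector_field_def complex_eq_iff algebra_simps)
  ultimately show "((\<lambda>t. a *\<^sub>R X t + b *\<^sub>R Y t) has_vector_derivative
      w *\<^sub>R vector_field t (a *\<^sub>R X t + b *\<^sub>R Y t)) (at t within {0..1})" by simp
qed

text \<open>Liouville's formula for a coefficient matrix of trace zero. With the initial values 1
  and i it says that the transfer matrix has determinant 1.\<close>

lemma wronskian_constant:
  assumes X: "solution w X" and Y: "solution w Y" and t: "t \<in> {0..1}"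
  shows "Re (X t) * Im (Y t) - Im (X t) * Re (Y t) = Re (X 0) * Im (Y 0) - Im (X 0) * Re (Y 0)"
proof -
  have deriv: "((\<lambda>t. Re (X t) * Im (Y t) - Im (X t) * Re (Y t)) has_vector_derivative 0)
      (at s within {0..1})" if s: "s \<in> {0..1}" for s
  proof -
    have d: "((\<lambda>t. Re (Z t)) has_vector_derivative w * (u s * Im (Z s))) (at s within {0..1})"
      "((\<lambda>t. Im (Z t)) has_vector_derivative - (w * (v s * Re (Z s)))) (at s within {0..1})"
      if Z: "solution w Z" for Z
    proof -
      have "(Z has_vector_derivative w *\<^sub>R vector_field s (Z s)) (at s within {0..1})"
        using Z s unfolding solution_def by blast
      from bounded_linear.has_vector_derivative[OF bounded_linear_Re this]
        bounded_linear.has_vector_derivative[OF bounded_linear_Im this]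
      show "((\<lambda>t. Re (Z t)) has_vector_derivative w * (u s * Im (Z s))) (at s within {0..1})"
        "((\<lambda>t. Im (Z t)) has_vector_derivative - (w * (v s * Re (Z s)))) (at s within {0..1})"
        by (simp_all add: vector_field_def)
    qed
    note d[OF X] d[OF Y]
    from has_vector_derivative_diff[OF has_vector_derivative_mult[OF this(1,4)]
        has_vector_derivative_mult[OF this(2,3)]]
    show ?thesis by (rule has_vector_derivative_eq_rhs) (simp add: algebra_simps)
  qed
  have "\<exists>c. \<forall>s\<in>{0..1}. Re (X s) * Im (Y s) - Im (X s) * Re (Y s) = c"
    by (rule has_derivative_zero_constant) (use deriv in \<open>auto simp: has_vector_derivative_def\<close>)
  then show ?thesis using t by auto
qed

text \<open>Along a zero-free solution the quotient q = X' / X turns the real-linear system into the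
  scalar complex equation X' = q X. The primitive of q is a continuous logarithm, so no branch of
  the argument has to be chosen.\<close>

lemma solution_exp_integral:
  assumes X: "solution w X" and nz: "\<And>t. t \<in> {0..1} \<Longrightarrow> X t \<noteq> 0"
  shows "X 1 = X 0 * exp (integral {0..1} (\<lambda>t. w *\<^sub>R vector_field t (X t) / X t))"
proof -
  define q where "q t = w *\<^sub>R vector_field t (X t) / X t" for t
  have cq: "continuous_on {0..1} q"
    unfolding q_def vector_field_def
    by (intro continuous_intros solution_continuous[OF X] continuous_u continuous_v) (use nz in auto)
  have deriv: "((\<lambda>t. X t * exp (- integral {0..t} q)) has_vector_derivative 0) (at t within {0..1})"
    if t: "t \<in> {0..1}" for t
  proof -
    have "((\<lambda>t. - integral {0..t} q) has_vector_derivative - q t) (at t within {0..1})"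
      by (intro has_vector_derivative_minus integral_has_vector_derivative cq t)
    then have "(exp \<circ> (\<lambda>t. - integral {0..t} q) has_vector_derivative
        - q t * exp (- integral {0..t} q)) (at t within {0..1})"
      by (rule field_vector_diff_chain_within)
        (auto intro!: derivative_eq_intros simp: has_field_derivative_at_within)
    moreover have "q t * X t = w *\<^sub>R vector_field t (X t)"
      using nz[OF t] by (simp add: q_def scaleR_conv_of_real)
    then have "(X has_vector_derivative q t * X t) (at t within {0..1})"
      using X t unfolding solution_def by simp
    ultimately have "((\<lambda>t. X t * (exp \<circ> (\<lambda>t. - integral {0..t} q)) t) has_vector_derivative
        X t * (- q t * exp (- integral {0..t} q)) + q t * X t * (exp \<circ> (\<lambda>t. - integral {0..t} q)) t)
        (at t within {0..1})"
      by (intro has_vector_derivative_mult)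
    then show ?thesis by (simp add: o_def)
  qed
  have "\<exists>c. \<forall>s\<in>{0..1}. X s * exp (- integral {0..s} q) = c"
    by (rule has_derivative_zero_constant) (use deriv in \<open>auto simp: has_vector_derivative_def\<close>)
  then have "X 1 * exp (- integral {0..1} q) = X 0" by force
  then show ?thesis unfolding q_def by (simp add: exp_minus field_simps)
qed

text \<open>The angular velocity is \<open>-w\<close> times a weighted mean of \<open>v t\<close>
  and \<open>u t\<close>, with the squared coordinates of \<open>z\<close> as weights; such a mean
  is at least the minimum. At \<open>z = 0\<close> both sides are 0 by the convention for division
  by zero.\<close>

lemma Im_vector_field_div:
  "Im (w *\<^sub>R vector_field t z / z) = - (w * ((v t * (Re z)\<^sup>2 + u t * (Im z)\<^sup>2) / ((Re z)\<^sup>2 + (Im z)\<^sup>2)))"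
  by (simp add: Im_divide vector_field_def power2_eq_square divide_simps) (simp add: algebra_simps)

lemma integral_min_pos: "0 < integral {0..1} (\<lambda>t. min (u t) (v t))"
proof -
  have c: "continuous_on {0..1} (\<lambda>t. min (u t) (v t))"
    by (intro continuous_intros continuous_u continuous_v)
  have n: "\<And>t. t \<in> {0..1} \<Longrightarrow> 0 \<le> min (u t) (v t)" using u_nonneg v_nonneg by simp
  have "integral {0..1} (\<lambda>t. min (u t) (v t)) \<noteq> 0"
    using integral_eq_0_iff[OF c _ n] u_pos v_pos by (force dest: bspec[of _ _ "1/2"])
  moreover have "0 \<le> integral {0..1} (\<lambda>t. min (u t) (v t))"
    using n by (intro integral_nonneg integrable_continuous_real c)
  ultimately show ?thesis by simp
qed

text \<open>The logarithm of a solution moves by the integral of its logarithmic derivative, whose imaginary part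
  is at most \<open>- w * min (u t) (v t)\<close>, so the argument of the end point tends to \<open>-\<infinity>\<close> with \<open>w\<close>.\<close>

lemma direction_attained:
  assumes cX: "\<And>R. continuous_on ({-R..R} \<times> {0..1}) (\<lambda>(w, t). X w t)"
    and X0: "\<And>w. X w 0 = x" and X: "\<And>w. solution w (X w)"
    and nz: "\<And>w t. t \<in> {0..1} \<Longrightarrow> X w t \<noteq> 0" and n: "n \<noteq> 0"
  obtains w s where "1 \<le> w" "0 < s" "X w 1 = s *\<^sub>R n"
proof -
  define q where "q w t = w *\<^sub>R vector_field t (X w t) / X w t" for w t
  define L where "L w = integral {0..1} (q w)" for w
  define \<kappa> where "\<kappa> = integral {0..1} (\<lambda>t. min (u t) (v t))"
  have \<kappa>: "0 < \<kappa>" unfolding \<kappa>_def by (rule integral_min_pos)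
  have X1: "X w 1 = x * exp (L w)" for w
    using solution_exp_integral[OF X nz, of w] by (simp add: X0 L_def q_def[abs_def])
  have cq: "continuous_on ({-R..R} \<times> {0..1}) (\<lambda>(w, t). q w t)" for R
    using cX[of R] nz
    unfolding q_def vector_field_def case_prod_unfold
    by (intro continuous_intros continuous_on_compose2[OF continuous_u]
        continuous_on_compose2[OF continuous_v]) auto
  have cL: "continuous_on {-R..R} L" for R
    using integral_continuous_on_param[of "{-R..R}" 0 1 q] cq[of R] unfolding L_def by simp
  have cq1: "continuous_on {0..1} (q w)" for w
    unfolding q_def vector_field_def
    by (intro continuous_intros solution_continuous[OF X] continuous_u continuous_v) (use nz in auto)
  have ImL: "Im (L w) \<le> - w * \<kappa>" if w: "0 \<le> w" for w
  proof -
    have "Im (L w) = integral {0..1} (\<lambda>t. Im (q w t))"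
      unfolding L_def
      using integral_linear[OF integrable_continuous_real[OF cq1] bounded_linear_Im, of w] by (simp add: o_def)
    also have "\<dots> \<le> integral {0..1} (\<lambda>t. - w * min (u t) (v t))"
    proof (intro integral_le integrable_continuous_real continuous_intros cq1 continuous_u continuous_v)
      fix t :: real assume t: "t \<in> {0..1}"
      let ?a = "(Re (X w t))\<^sup>2" and ?b = "(Im (X w t))\<^sup>2"
      have ab: "0 < ?a + ?b" using nz[OF t, of w]
        by (metis complex_eq_0 less_le sum_power2_ge_zero)
      have "min (u t) (v t) * (?a + ?b) \<le> v t * ?a + u t * ?b"
        unfolding distrib_left by (intro add_mono mult_right_mono) auto
      then have "min (u t) (v t) \<le> (v t * ?a + u t * ?b) / (?a + ?b)"
        using ab by (simp add: pos_le_divide_eq)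
      then have "w * min (u t) (v t) \<le> w * ((v t * ?a + u t * ?b) / (?a + ?b))"
        using w by (intro mult_left_mono)
      then show "Im (q w t) \<le> - w * min (u t) (v t)"
        unfolding q_def Im_vector_field_div by simp
    qed
    also have "\<dots> = - w * \<kappa>" unfolding \<kappa>_def by simp
    finally show ?thesis .
  qed
  define \<theta> where "\<theta> = Arg (n / x)"
  have x: "x \<noteq> 0" using nz[of 0] X0 by force
  \<comment> \<open>Full turns are subtracted from the target angle until it lies below the angle
    reached at \<open>w = 1\<close>, so that the parameter found is at least 1.\<close>
  obtain N :: nat where N: "real N > (\<theta> - Im (L 1)) / (2 * pi)" using reals_Archimedean2 by blast
  define y where "y = \<theta> - 2 * pi * real N"
  have y1: "y \<le> Im (L 1)" using N unfolding y_def by (simp add: field_simps)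
  \<comment> \<open>At \<open>w = R\<close> the bound \<open>ImL\<close> has pushed the angle down
    to \<open>y\<close> or below, which gives the other end for the intermediate value
    theorem.\<close>
  define R where "R = max 1 (- y / \<kappa>)"
  have R: "1 \<le> R" "- R * \<kappa> \<le> y"
  proof -
    have "- y / \<kappa> * \<kappa> \<le> R * \<kappa>" using \<kappa> by (intro mult_right_mono) (auto simp: R_def)
    then show "- R * \<kappa> \<le> y" using \<kappa> by simp
  qed (simp add: R_def)
  have "\<exists>w. 1 \<le> w \<and> w \<le> R \<and> Im (L w) = y"
    using R ImL[of R] y1
    by (intro IVT2' continuous_intros continuous_on_subset[OF cL[of R]]) auto
  then obtain w where w: "1 \<le> w" "Im (L w) = y" by blast
  have "n / x = of_real (cmod (n / x)) * exp (\<i> * of_real \<theta>)"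
    unfolding \<theta>_def using Arg_eq[of "n / x"] n x by simp
  also have "exp (\<i> * of_real \<theta>) = exp (\<i> * of_real y)"
  proof -
    have "\<i> * of_real \<theta> = \<i> * of_real y + of_nat N * (2 * of_real pi * \<i>)"
      unfolding y_def by (simp add: algebra_simps)
    then show ?thesis by (simp add: exp_add exp_of_nat_mult)
  qed
  finally have nx: "n = x * of_real (cmod (n / x)) * exp (\<i> * of_real y)"
    using x by (simp add: field_simps)
  have "L w = of_real (Re (L w)) + \<i> * of_real y" using w by (simp add: complex_eq_iff)
  then have "exp (L w) = of_real (exp (Re (L w))) * exp (\<i> * of_real y)"
    by (metis exp_add exp_of_real)
  then have "X w 1 = (exp (Re (L w)) / cmod (n / x)) *\<^sub>R n"
    using n x by (subst nx) (simp add: X1 scaleR_conv_of_real)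
  then show thesis using that[of w "exp (Re (L w)) / cmod (n / x)"] w n x by simp
qed

end

section \<open>Eigenvalues of unitary boundary conditions\<close>

lemma singular_2x2_kernel:
  fixes p q r s :: "'a::field"
  assumes "p * s - q * r = 0"
  obtains y b where "y \<noteq> 0 \<or> b \<noteq> 0" "p * y + q * b = 0" "r * y + s * b = 0"
proof (cases "p = 0 \<and> q = 0")
  case True
  then show thesis
    using that[of s "- r"] that[of 1 0] by (cases "s = 0 \<and> r = 0") (auto simp: algebra_simps)
next
  case False
  then show thesis using that[of q "- p"] assms by (auto simp: algebra_simps)
qed

context planar_system
begin

text \<open>The linear form is the trace of \<open>N T\<close>, where \<open>T\<close> is the transfer matrix with columns
  \<open>X w 1\<close> and \<open>Y w 1\<close>, of determinant 1.  If \<open>det N > 0\<close>, choose \<open>w\<close> such that the first basis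
  vector is an eigenvector of \<open>N T\<close>; the product of the eigenvalues is \<open>det N\<close>.
  If \<open>N\<close> is the rank-one matrix \<open>m n\<^sup>T\<close>, choose \<open>w\<close> such that \<open>T m\<close> is a multiple of \<open>n\<close>.\<close>

lemma trace_attains_sign:
  fixes n11 n12 n21 n22 \<sigma> :: real
  assumes cX: "\<And>R. continuous_on ({-R..R} \<times> {0..1}) (\<lambda>(w, t). X w t)"
    and X0: "\<And>w. X w 0 = 1" and X: "\<And>w. solution w (X w)"
    and cY: "\<And>R. continuous_on ({-R..R} \<times> {0..1}) (\<lambda>(w, t). Y w t)"
    and Y0: "\<And>w. Y w 0 = \<i>" and Y: "\<And>w. solution w (Y w)"
    and N: "n11 \<noteq> 0 \<or> n12 \<noteq> 0 \<or> n21 \<noteq> 0 \<or> n22 \<noteq> 0"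
    and det: "0 \<le> n11 * n22 - n12 * n21" and \<sigma>: "\<sigma> = 1 \<or> \<sigma> = -1"
  obtains w where "1 \<le> w"
    "2 * sqrt (n11 * n22 - n12 * n21) \<le>
      \<sigma> * (n11 * Re (X w 1) + n12 * Im (X w 1) + n21 * Re (Y w 1) + n22 * Im (Y w 1))"
proof -
  have wr: "Re (X w t) * Im (Y w t) - Im (X w t) * Re (Y w t) = 1" if "t \<in> {0..1}" for w t
    using wronskian_constant[OF X Y that] by (simp add: X0 Y0)
  have hit: "\<exists>w s. 1 \<le> w \<and> 0 < s \<and> m1 *\<^sub>R X w 1 + m2 *\<^sub>R Y w 1 = s *\<^sub>R n"
    if m: "m1 \<noteq> 0 \<or> m2 \<noteq> 0" and n: "n \<noteq> 0" for m1 m2 n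
  proof -
    let ?Z = "\<lambda>w t. m1 *\<^sub>R X w t + m2 *\<^sub>R Y w t"
    have cont: "continuous_on ({-R..R} \<times> {0..1}) (\<lambda>(w, t). ?Z w t)" for R
      using cX[of R] cY[of R] unfolding case_prod_unfold by (intro continuous_intros)
    \<comment> \<open>A zero would make the two columns of the transfer matrix dependent, against
      determinant 1.\<close>
    have nz: "?Z w t \<noteq> 0" if t: "t \<in> {0..1}" for w t
    proof
      assume "?Z w t = 0"
      then have "m1 * Re (X w t) + m2 * Re (Y w t) = 0" "m1 * Im (X w t) + m2 * Im (Y w t) = 0"
        by (simp_all add: complex_eq_iff)
      then have "m1 = 0" "m2 = 0" using wr[OF t, of w] by algebra+
      then show False using m by simp
    qed
    show ?thesis
      by (rule direction_attained[OF cont _ solution_lincomb[OF X Y] nz n]) (auto simp: X0 Y0)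
  qed
  consider (pos) "0 < n11 * n22 - n12 * n21"
    | (row1) "n11 * n22 - n12 * n21 = 0" "n11 \<noteq> 0 \<or> n12 \<noteq> 0"
    | (row2) "n11 = 0" "n12 = 0" "n21 \<noteq> 0 \<or> n22 \<noteq> 0"
    using det N by fastforce
  then show thesis
  proof cases
    case pos
    let ?d = "n11 * n22 - n12 * n21"
    \<comment> \<open>The second row of \<open>N\<close> annihilates this direction, so once
      \<open>X w 1\<close> points along it \<open>N T\<close> is upper triangular, with diagonal
      entries \<open>\<sigma> * s * ?d\<close> and \<open>\<sigma> * z\<close>.\<close>
    have "\<sigma> *\<^sub>R Complex n22 (- n21) \<noteq> 0" using pos \<sigma> by (auto simp: complex_eq_iff)
    from hit[of 1 0, OF _ this] obtain w s where w: "1 \<le> w" "0 < s"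
      and e: "X w 1 = s *\<^sub>R (\<sigma> *\<^sub>R Complex n22 (- n21))" by auto
    have r: "Re (X w 1) = s * \<sigma> * n22" "Im (X w 1) = - s * \<sigma> * n21"
      unfolding e by simp_all
    define z where "z = \<sigma> * (n21 * Re (Y w 1) + n22 * Im (Y w 1))"
    have "s * z = Re (X w 1) * Im (Y w 1) - Im (X w 1) * Re (Y w 1)"
      unfolding r z_def by (simp add: algebra_simps)
    then have sz: "s * z = 1" using wr[of 1 w] by simp
    have tr: "\<sigma> * (n11 * Re (X w 1) + n12 * Im (X w 1) + n21 * Re (Y w 1) + n22 * Im (Y w 1)) = s * ?d + z"
      unfolding r z_def using \<sigma> by (auto simp: algebra_simps)
    \<comment> \<open>The inequality of arithmetic and geometric means for \<open>s * ?d\<close> and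
      \<open>z = 1 / s\<close>.\<close>
    have "0 \<le> (s * sqrt ?d - 1)\<^sup>2" by simp
    also have "\<dots> = s * (s * ?d + z - 2 * sqrt ?d)"
      using sz pos by (simp add: power2_diff power_mult_distrib) (simp add: algebra_simps power2_eq_square)
    finally have "0 \<le> s * ?d + z - 2 * sqrt ?d" using w by (simp add: zero_le_mult_iff)
    then show thesis using that[OF w(1)] tr by simp
  next
    case row1
    \<comment> \<open>With determinant 0 and a nonzero first row, the second row is a multiple of
      the first; the column of the rank-one factorisation is \<open>(1, k)\<close>.\<close>
    obtain k where k: "n21 = k * n11" "n22 = k * n12"
    proof (cases "n11 = 0")
      case True
      then show thesis using row1 that[of "n22 / n12"] by auto
    next
      case False
      then show thesis using row1 that[of "n21 / n11"] by (auto simp: field_simps)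
    qed
    have "\<sigma> *\<^sub>R Complex n11 n12 \<noteq> 0" using row1 \<sigma> by (auto simp: complex_eq_iff)
    from hit[of 1 k, OF _ this] obtain w s where w: "1 \<le> w" "0 < s"
      and e: "X w 1 + k *\<^sub>R Y w 1 = s *\<^sub>R (\<sigma> *\<^sub>R Complex n11 n12)" by auto
    have r: "Re (X w 1) + k * Re (Y w 1) = s * \<sigma> * n11" "Im (X w 1) + k * Im (Y w 1) = s * \<sigma> * n12"
      using arg_cong[OF e, of Re] arg_cong[OF e, of Im] by simp_all
    have "n11 * Re (X w 1) + n12 * Im (X w 1) + n21 * Re (Y w 1) + n22 * Im (Y w 1)
        = n11 * (Re (X w 1) + k * Re (Y w 1)) + n12 * (Im (X w 1) + k * Im (Y w 1))"
      unfolding k by (simp add: algebra_simps)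
    also have "\<dots> = \<sigma> * (s * (n11\<^sup>2 + n12\<^sup>2))"
      unfolding r by (simp add: algebra_simps power2_eq_square)
    finally show thesis using that[OF w(1)] row1 \<sigma> w by auto
  next
    case row2
    have "\<sigma> *\<^sub>R Complex n21 n22 \<noteq> 0" using row2 \<sigma> by (auto simp: complex_eq_iff)
    from hit[of 0 1, OF _ this] obtain w s where w: "1 \<le> w" "0 < s"
      and e: "Y w 1 = s *\<^sub>R (\<sigma> *\<^sub>R Complex n21 n22)" by auto
    have "n11 * Re (X w 1) + n12 * Im (X w 1) + n21 * Re (Y w 1) + n22 * Im (Y w 1)
        = \<sigma> * (s * (n21\<^sup>2 + n22\<^sup>2))"
      unfolding e row2 by (simp add: algebra_simps power2_eq_square)
    then show thesis using that[OF w(1)] row2 \<sigma> w by auto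
  qed
qed

text \<open>Since \<open>\<bar>\<beta>\<bar>\<close> is at most the square root of the determinant,
  the two signs in \<open>trace_attains_sign\<close> enclose \<open>2 * \<beta>\<close>. Both
  parameters found there are at least 1, hence so is every parameter between them.\<close>

lemma trace_attains_value:
  fixes n11 n12 n21 n22 \<beta> :: real
  assumes cX: "\<And>R. continuous_on ({-R..R} \<times> {0..1}) (\<lambda>(w, t). X w t)"
    and X0: "\<And>w. X w 0 = 1" and X: "\<And>w. solution w (X w)"
    and cY: "\<And>R. continuous_on ({-R..R} \<times> {0..1}) (\<lambda>(w, t). Y w t)"
    and Y0: "\<And>w. Y w 0 = \<i>" and Y: "\<And>w. solution w (Y w)"
    and N: "n11 \<noteq> 0 \<or> n12 \<noteq> 0 \<or> n21 \<noteq> 0 \<or> n22 \<noteq> 0"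
    and det: "\<beta>\<^sup>2 \<le> n11 * n22 - n12 * n21"
  obtains w where "1 \<le> w"
    "n11 * Re (X w 1) + n12 * Im (X w 1) + n21 * Re (Y w 1) + n22 * Im (Y w 1) = 2 * \<beta>"
proof -
  define tr where
    "tr w = n11 * Re (X w 1) + n12 * Im (X w 1) + n21 * Re (Y w 1) + n22 * Im (Y w 1)" for w
  have det0: "0 \<le> n11 * n22 - n12 * n21" using det zero_le_power2[of \<beta>] by linarith
  have \<beta>: "\<bar>\<beta>\<bar> \<le> sqrt (n11 * n22 - n12 * n21)"
    using real_sqrt_le_mono[OF det] by simp
  note sgn = trace_attains_sign[OF cX X0 X cY Y0 Y N det0]
  obtain w1 where w1: "1 \<le> w1" "2 * \<beta> \<le> tr w1"
    using sgn[of 1] \<beta> unfolding tr_def by (smt (verit, best))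
  obtain w2 where w2: "1 \<le> w2" "tr w2 \<le> 2 * \<beta>"
    using sgn[of "-1"] \<beta> unfolding tr_def by (smt (verit, best))
  have "continuous_on {1..R} tr" for R
  proof -
    have "continuous_on {1..R} (\<lambda>w. Z w 1)"
      if "continuous_on ({-R..R} \<times> {0..1}) (\<lambda>(w, t). Z w t)" for Z :: "real \<Rightarrow> real \<Rightarrow> complex"
      using continuous_on_compose2[OF that, of "{1..R}" "\<lambda>w. (w, 1)"]
      by (force intro!: continuous_intros)
    from this[OF cX] this[OF cY] show ?thesis
      unfolding tr_def by (intro continuous_intros)
  qed
  then have "continuous_on {w1..w2} tr" "continuous_on {w2..w1} tr"
    using w1 w2 by (meson atLeastatMost_subset_iff continuous_on_subset order_refl)+
  then obtain w where "min w1 w2 \<le> w" "tr w = 2 * \<beta>"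
    using IVT2'[of tr w2 "2 * \<beta>" w1] IVT'[of tr w2 "2 * \<beta>" w1] w1 w2
    by (cases "w1 \<le> w2") fastforce+
  then show thesis using that[of w] w1 w2 unfolding tr_def by simp
qed

text \<open>A unitary matrix with first row \<open>A\<close>, \<open>B\<close> and determinant \<open>\<eta>\<^sup>2\<close> has second row
  \<open>- \<eta>\<^sup>2 * cnj B\<close>, \<open>\<eta>\<^sup>2 * cnj A\<close>.  Up to the phase \<open>\<eta>\<close> the boundary determinant is real,
  which is what makes the intermediate value theorem applicable.\<close>

lemma unitary_boundary_determinant:
  fixes A B C D P Q R S \<eta> :: complex
  assumes D: "D = \<eta>\<^sup>2 * cnj A" and C: "C = - (\<eta>\<^sup>2 * cnj B)" and \<eta>: "\<eta> * cnj \<eta> = 1"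
    and AB: "A * cnj A + B * cnj B = 1" and det: "Q * R - S * P = 1"
  shows "((1 - A) * P - \<i> * (1 + A) * Q + \<i> * B) * (1 - D - C * R - \<i> * C * S)
     - ((1 - A) * R - \<i> * (1 + A) * S - B) * (\<i> * (1 + D) - C * P - \<i> * C * Q)
   = 2 * \<eta> * (of_real (Re \<eta> - Re (A * cnj \<eta>)) * P - of_real (Re \<eta> + Re (A * cnj \<eta>)) * S
      + of_real (Im (A * cnj \<eta>) - Im \<eta>) * Q - of_real (Im \<eta> + Im (A * cnj \<eta>)) * R
      - of_real (2 * Im (B * cnj \<eta>)))"
proof -
  \<comment> \<open>Conjugates and the imaginary unit become independent variables, so that the
    claim is a polynomial identity modulo the relations between them.\<close>
  define e where "e = cnj \<eta>"
  define j where "j = \<i>"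
  define a where "a = cnj A" define b where "b = cnj B"
  have j: "j * j = -1" unfolding j_def by simp
  have re: "2 * complex_of_real (Re z) = z + cnj z" "2 * complex_of_real (Im z) = - j * (z - cnj z)" for z
    unfolding j_def by (simp_all add: complex_eq_iff)
  have "2 * \<eta> * (of_real (Re \<eta> - Re (A * cnj \<eta>)) * P - of_real (Re \<eta> + Re (A * cnj \<eta>)) * S
      + of_real (Im (A * cnj \<eta>) - Im \<eta>) * Q - of_real (Im \<eta> + Im (A * cnj \<eta>)) * R
      - of_real (2 * Im (B * cnj \<eta>)))
    = \<eta> * ((2 * of_real (Re \<eta>) - 2 * of_real (Re (A * cnj \<eta>))) * P
      - (2 * of_real (Re \<eta>) + 2 * of_real (Re (A * cnj \<eta>))) * S
      + (2 * of_real (Im (A * cnj \<eta>)) - 2 * of_real (Im \<eta>)) * Q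
      - (2 * of_real (Im \<eta>) + 2 * of_real (Im (A * cnj \<eta>))) * R
      - 2 * (2 * of_real (Im (B * cnj \<eta>))))"
    by (simp add: algebra_simps)
  also have "\<dots> = \<eta> * ((\<eta> + e - (A * e + a * \<eta>)) * P - (\<eta> + e + (A * e + a * \<eta>)) * S
      + (- j * (A * e - a * \<eta>) + j * (\<eta> - e)) * Q - (- j * (\<eta> - e) - j * (A * e - a * \<eta>)) * R
      + 2 * (j * (B * e - b * \<eta>)))"
    unfolding re by (simp add: e_def a_def b_def algebra_simps)
  also have "\<dots> = ((1 - A) * P - j * (1 + A) * Q + j * B) * (1 - D - C * R - j * C * S)
     - ((1 - A) * R - j * (1 + A) * S - B) * (j * (1 + D) - C * P - j * C * Q)"
  proof -
    have "\<eta> * e = 1" "A * a + B * b = 1" "D = \<eta>\<^sup>2 * a" "C = - (\<eta>\<^sup>2 * b)"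
      using D C \<eta> AB by (simp_all add: e_def a_def b_def)
    then have AD: "A * D - B * C = \<eta>\<^sup>2" "\<eta> * a * \<eta> = D" "\<eta> * b * \<eta> = - C" "\<eta> * (A * e) = A" "\<eta> * (B * e) = B"
      by algebra+
    show ?thesis using j AD det \<open>\<eta> * e = 1\<close> by algebra
  qed
  finally show ?thesis unfolding j_def by simp
qed

text \<open>The left values \<open>y\<close>, \<open>b\<close> are the unknowns. The transfer matrix
  turns them into the right values \<open>x\<close>, \<open>a\<close>, so the boundary condition is
  a homogeneous 2x2 system, and \<open>w\<close> is chosen to annul its determinant, known from
  \<open>unitary_boundary_determinant\<close>.\<close>

lemma unitary_boundary_eigenvalue:
  fixes A B C D \<eta> :: complex
  assumes D: "D = \<eta>\<^sup>2 * cnj A" and C: "C = - (\<eta>\<^sup>2 * cnj B)" and \<eta>: "\<eta> * cnj \<eta> = 1"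
    and AB: "A * cnj A + B * cnj B = 1"
  obtains w X Y and y b x a :: complex where "1 \<le> w" "solution w X" "solution w Y" "y \<noteq> 0 \<or> b \<noteq> 0" "x \<noteq> 0 \<or> a \<noteq> 0"
    "X 0 = 1" "Y 0 = \<i>"
    "x = y * Re (X 1) + b * Re (Y 1)" "a = y * Im (X 1) + b * Im (Y 1)"
    "(1 - A) * a - B * b = \<i> * ((1 + A) * x - B * y)"
    "- C * a + (1 - D) * b = \<i> * (C * x - (1 + D) * y)"
proof -
  obtain X where cX: "\<And>R. continuous_on ({-R..R} \<times> {0..1}) (\<lambda>(w, t). X w t)"
    and X0: "\<And>w. X w 0 = 1" and X: "\<And>w. solution w (X w)" using solution_family[of 1] by metis
  obtain Y where cY: "\<And>R. continuous_on ({-R..R} \<times> {0..1}) (\<lambda>(w, t). Y w t)"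
    and Y0: "\<And>w. Y w 0 = \<i>" and Y: "\<And>w. solution w (Y w)" using solution_family[of \<i>] by metis
  define \<alpha> where "\<alpha> = A * cnj \<eta>"
  define \<beta> where "\<beta> = B * cnj \<eta>"
  have \<eta>2: "(Re \<eta>)\<^sup>2 + (Im \<eta>)\<^sup>2 = 1"
    using arg_cong[OF \<eta>, of Re] by (simp add: power2_eq_square)
  have "\<alpha> * cnj \<alpha> + \<beta> * cnj \<beta> = 1"
    using \<eta> AB unfolding \<alpha>_def \<beta>_def complex_cnj_mult complex_cnj_cnj by algebra
  from arg_cong[OF this, of Re] have \<alpha>\<beta>: "(Re \<alpha>)\<^sup>2 + (Im \<alpha>)\<^sup>2 + (Re \<beta>)\<^sup>2 + (Im \<beta>)\<^sup>2 = 1"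
    by (simp add: power2_eq_square)
  \<comment> \<open>The matrix of the linear form has determinant 1 - |alpha|^2 = |beta|^2, while
    the value to be attained is twice the imaginary part of \<open>\<beta>\<close>.\<close>
  have det: "(Im \<beta>)\<^sup>2 \<le> (Im \<alpha> - Im \<eta>) * (- (Im \<eta> + Im \<alpha>)) - (Re \<eta> - Re \<alpha>) * (- (Re \<eta> + Re \<alpha>))"
  proof -
    have "(Im \<alpha> - Im \<eta>) * (- (Im \<eta> + Im \<alpha>)) - (Re \<eta> - Re \<alpha>) * (- (Re \<eta> + Re \<alpha>)) = (Re \<beta>)\<^sup>2 + (Im \<beta>)\<^sup>2"
      using \<eta>2 \<alpha>\<beta> by algebra
    then show ?thesis by simp
  qed
  have N: "Im \<alpha> - Im \<eta> \<noteq> 0 \<or> Re \<eta> - Re \<alpha> \<noteq> 0 \<or> - (Re \<eta> + Re \<alpha>) \<noteq> 0 \<or> - (Im \<eta> + Im \<alpha>) \<noteq> 0"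
  proof (rule ccontr)
    assume "\<not> ?thesis"
    then have "Re \<eta> = 0" "Im \<eta> = 0" by auto
    then show False using \<eta>2 by simp
  qed
  obtain w where w: "1 \<le> w" and tr: "(Im \<alpha> - Im \<eta>) * Re (X w 1) + (Re \<eta> - Re \<alpha>) * Im (X w 1)
      + (- (Re \<eta> + Re \<alpha>)) * Re (Y w 1) + (- (Im \<eta> + Im \<alpha>)) * Im (Y w 1) = 2 * Im \<beta>"
    using trace_attains_value[OF cX X0 X cY Y0 Y N det] by metis
  define Q P S R where "Q = complex_of_real (Re (X w 1))" and "P = complex_of_real (Im (X w 1))"
    and "S = complex_of_real (Re (Y w 1))" and "R = complex_of_real (Im (Y w 1))"
  have wr: "Q * R - S * P = 1"
  proof -
    have "Re (X w 1) * Im (Y w 1) - Im (X w 1) * Re (Y w 1) = 1"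
      using wronskian_constant[OF X Y, of 1 w] by (simp add: X0 Y0)
    from arg_cong[OF this, of complex_of_real] show ?thesis
      unfolding Q_def P_def R_def S_def by (simp add: mult.commute)
  qed
  have "of_real (Re \<eta> - Re \<alpha>) * P - of_real (Re \<eta> + Re \<alpha>) * S
      + of_real (Im \<alpha> - Im \<eta>) * Q - of_real (Im \<eta> + Im \<alpha>) * R - of_real (2 * Im \<beta>) = 0"
    using arg_cong[OF tr, of complex_of_real] unfolding Q_def P_def R_def S_def
    by (simp add: algebra_simps)
  then have "((1 - A) * P - \<i> * (1 + A) * Q + \<i> * B) * (1 - D - C * R - \<i> * C * S)
     - ((1 - A) * R - \<i> * (1 + A) * S - B) * (\<i> * (1 + D) - C * P - \<i> * C * Q) = 0"
    unfolding unitary_boundary_determinant[OF D C \<eta> AB wr] \<alpha>_def \<beta>_def by simp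
  from singular_2x2_kernel[OF this] obtain y b where yb: "y \<noteq> 0 \<or> b \<noteq> 0"
    "((1 - A) * P - \<i> * (1 + A) * Q + \<i> * B) * y + ((1 - A) * R - \<i> * (1 + A) * S - B) * b = 0"
    "(\<i> * (1 + D) - C * P - \<i> * C * Q) * y + (1 - D - C * R - \<i> * C * S) * b = 0"
    by metis
  \<comment> \<open>The transfer matrix is invertible, so nonzero left data give nonzero right
    data.\<close>
  have xa: "y * Q + b * S \<noteq> 0 \<or> y * P + b * R \<noteq> 0"
  proof (rule ccontr)
    assume "\<not> ?thesis"
    then have "y * Q + b * S = 0" "y * P + b * R = 0" by auto
    then have "y = 0" "b = 0" using wr by algebra+
    then show False using yb by simp
  qed
  show thesis
  proof (rule that[OF w X Y yb(1) xa X0 Y0])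
    show "(1 - A) * (y * P + b * R) - B * b = \<i> * ((1 + A) * (y * Q + b * S) - B * y)"
      using yb(2) by (simp add: algebra_simps add_eq_0_iff)
    show "- C * (y * P + b * R) + (1 - D) * b = \<i> * (C * (y * Q + b * S) - (1 + D) * y)"
      using yb(3) by (simp add: algebra_simps)
  qed (simp_all add: P_def Q_def R_def S_def)
qed

end

section \<open>The Dirac operator\<close>

text \<open>With \<open>e = (1 - 2 * M) / 4\<close> the derivative of \<open>clock e\<close> has stronger singularities at the end points
  than \<open>\<sigma>\<close> to the powers \<open>\<plusminus> 2 * M\<close>; \<open>rate e\<close> is the quotient, as a function of the new variable.\<close>

definition clock :: "real \<Rightarrow> real \<Rightarrow> real" where
  "clock e \<rho> = (1 + sin \<rho>) powr e / ((1 + sin \<rho>) powr e + (1 - sin \<rho>) powr e)"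

definition rate :: "real \<Rightarrow> real \<Rightarrow> real" where
  "rate e t = t powr (1 / e - 3) * (1 - t) / (e * (t powr (1 / e) + (1 - t) powr (1 / e)))"

lemma one_plus_minus_sin_pos:
  assumes "\<rho> \<in> {- (pi / 2)<..<pi / 2}"
  shows "0 < 1 + sin \<rho>" "0 < 1 - sin \<rho>" "0 < cos \<rho>"
proof -
  show c: "0 < cos \<rho>" using assms by (intro cos_gt_zero_pi) auto
  have "0 < 1 - (sin \<rho>)\<^sup>2" using c by (simp flip: cos_squared_eq)
  then have "sin \<rho> \<noteq> 1" "sin \<rho> \<noteq> -1" by auto
  then show "0 < 1 + sin \<rho>" "0 < 1 - sin \<rho>"
    using sin_le_one[of \<rho>] sin_ge_minus_one[of \<rho>] by linarith+
qed

lemma powr_add_powr_pos: "0 < t powr k + (1 - t) powr k" for t k :: real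
  by (cases "t = 0") (simp_all add: add_pos_nonneg)

text \<open>For e = (1 - 2M) / 4 the two bounds are M < 1/2 and 0 <= M. The second makes the
  exponent \<open>1 / e - 3\<close> at least 1, so \<open>rate e\<close> is continuous and vanishes
  at 0. The other coefficient is a reflection because the change of sign of rho inverts sigma and
  replaces \<open>clock e\<close> by \<open>1 - clock e\<close>.\<close>

lemma planar_system_rate:
  assumes e: "0 < e" "e \<le> 1/4"
  shows "planar_system (rate e) (\<lambda>t. rate e (1 - t))"
proof
  have "4 \<le> 1 / e" using e by (simp add: field_simps)
  then have k: "0 < 1 / e - 3" "0 < 1 / e" by linarith+
  show c: "continuous_on {0..1} (rate e)"
    unfolding rate_def using k e powr_add_powr_pos
    by (intro continuous_intros continuous_on_powr') (auto simp: less_imp_neq[THEN not_sym])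
  show "continuous_on {0..1} (\<lambda>t. rate e (1 - t))"
    by (intro continuous_on_compose2[OF c] continuous_intros) auto
  show "0 \<le> rate e t" "0 \<le> rate e (1 - t)" if "t \<in> {0..1}" for t
    unfolding rate_def using that e by auto
  show "0 < rate e (1/2)" "0 < rate e (1 - 1/2)"
    unfolding rate_def using e by simp_all
qed

lemma clock_in_unit:
  assumes "\<rho> \<in> {- (pi / 2)<..<pi / 2}"
  shows "clock e \<rho> \<in> {0<..<1}"
  using one_plus_minus_sin_pos[OF assms] unfolding clock_def by (simp add: add_pos_pos)

text \<open>At t = A^e / S the sum t^(1/e) + (1-t)^(1/e) equals 2 / S^(1/e), because A + B = 2; this
  is how the denominator of \<open>rate\<close> eliminates \<open>S\<close>. The remaining exponents
  of A and B add up to M and -M. Keeping A and B as free variables allows them to be exchanged for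
  the second coefficient.\<close>

lemma rate_clock_deriv:
  fixes A B c e M :: real
  assumes A: "0 < A" and B: "0 < B" and AB: "A + B = 2" and c: "0 < c" "c\<^sup>2 = A * B"
    and e: "e = (1 - 2 * M) / 4" "0 < e"
  defines "S \<equiv> A powr e + B powr e"
  shows "rate e (A powr e / S) * (2 * e * c * (A * B) powr (e - 1) / S\<^sup>2) = (A / B) powr M"
proof -
  have S: "0 < S" unfolding S_def using A B by (simp add: add_pos_pos)
  have c': "c = A powr (1/2) * B powr (1/2)"
    using c A B by (metis powr_half_sqrt real_sqrt_mult real_sqrt_unique less_imp_le)
  have t1: "1 - A powr e / S = B powr e / S" using S unfolding S_def by (simp add: field_simps)
  have p: "(A powr e / S) powr (1 / e) = A / S powr (1 / e)"
    "(B powr e / S) powr (1 / e) = B / S powr (1 / e)"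
    "(A powr e / S) powr (1 / e - 3) = A powr (1 - 3 * e) / (S powr (1 / e) / S ^ 3)"
    using A B S e by (simp_all add: powr_divide powr_powr powr_diff[of S] algebra_simps)
  have "rate e (A powr e / S)
      = (A powr (1 - 3 * e) / (S powr (1 / e) / S ^ 3)) * (B powr e / S) / (e * ((A + B) / S powr (1 / e)))"
    unfolding rate_def t1 p by (simp add: add_divide_distrib)
  also have "\<dots> = A powr (1 - 3 * e) * B powr e * S\<^sup>2 / (2 * e)"
    unfolding AB using S e(2) by (simp add: field_simps power3_eq_cube power2_eq_square)
  finally have "rate e (A powr e / S) * (2 * e * c * (A * B) powr (e - 1) / S\<^sup>2)
      = A powr (1 - 3 * e) * B powr e * c * (A * B) powr (e - 1)"
    using S e(2) by simp
  also have "\<dots> = A powr (1 - 3 * e) * A powr (1/2) * A powr (e - 1) * (B powr e * B powr (1/2) * B powr (e - 1))"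
    unfolding c' using A B by (simp add: powr_mult)
  also have "\<dots> = A powr (1 - 3 * e + 1/2 + (e - 1)) * B powr (e + 1/2 + (e - 1))"
    unfolding powr_add ..
  also have "1 - 3 * e + 1/2 + (e - 1) = M"
    unfolding e by (simp add: field_simps)
  also have "e + 1/2 + (e - 1) = - M"
    unfolding e by (simp add: field_simps)
  also have "A powr M * B powr (- M) = (A / B) powr M"
    using A B by (simp add: powr_divide powr_minus_divide)
  finally show ?thesis .
qed

lemma sigma_powr:
  assumes "\<rho> \<in> {- (pi / 2)<..<pi / 2}"
  shows "sigma_fn \<rho> powr m = (1 - sin \<rho>) powr (m / 2) * (1 + sin \<rho>) powr (- m / 2)"
    and "sigma_fn \<rho> powr m = ((1 - sin \<rho>) / (1 + sin \<rho>)) powr (m / 2)"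
  using one_plus_minus_sin_pos[OF assms]
  by (simp_all add: sigma_fn_def powr_half_sqrt[symmetric] powr_powr powr_divide powr_minus_divide)

lemma clock_deriv:
  assumes \<rho>: "\<rho> \<in> {- (pi / 2)<..<pi / 2}" and M: "M < 1/2" and e: "e = (1 - 2 * M) / 4" and M0: "0 \<le> M"
  obtains d where "(clock e has_real_derivative d) (at \<rho>)"
    "rate e (clock e \<rho>) * d = sigma_fn \<rho> powr (- 2 * M)"
    "rate e (1 - clock e \<rho>) * d = sigma_fn \<rho> powr (2 * M)"
proof -
  let ?A = "1 + sin \<rho>" and ?B = "1 - sin \<rho>"
  note pos = one_plus_minus_sin_pos[OF \<rho>]
  let ?S = "?A powr e + ?B powr e"
  have S: "0 < ?S" using pos by (simp add: add_pos_pos)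
  have e0: "0 < e" using M e by simp
  have c2: "(cos \<rho>)\<^sup>2 = ?A * ?B"
    by (simp add: cos_squared_eq algebra_simps power2_eq_square)
  let ?d = "2 * e * cos \<rho> * (?A * ?B) powr (e - 1) / ?S\<^sup>2"
  have "((\<lambda>\<rho>. (1 + sin \<rho>) powr e / ((1 + sin \<rho>) powr e + (1 - sin \<rho>) powr e)) has_real_derivative
      ((e * ?A powr (e - 1) * cos \<rho>) * ?S - ?A powr e *
        (e * ?A powr (e - 1) * cos \<rho> + e * ?B powr (e - 1) * - cos \<rho>)) / (?S * ?S)) (at \<rho>)"
    using pos S by (auto intro!: derivative_eq_intros)
  moreover have "((e * ?A powr (e - 1) * cos \<rho>) * ?S - ?A powr e *
        (e * ?A powr (e - 1) * cos \<rho> + e * ?B powr (e - 1) * - cos \<rho>)) / (?S * ?S) = ?d"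
  proof -
    have "(e * ?A powr (e - 1) * cos \<rho>) * ?S - ?A powr e *
        (e * ?A powr (e - 1) * cos \<rho> + e * ?B powr (e - 1) * - cos \<rho>)
      = e * cos \<rho> * (?A powr (e - 1) * ?B powr e + ?A powr e * ?B powr (e - 1))"
      by (simp add: algebra_simps)
    also have "\<dots> = e * cos \<rho> * (?A powr (e - 1) * (?B powr (e - 1) * ?B)
        + (?A powr (e - 1) * ?A) * ?B powr (e - 1))"
      using pos powr_add[of ?A "e - 1" 1] powr_add[of ?B "e - 1" 1] by simp
    also have "\<dots> = 2 * e * cos \<rho> * (?A powr (e - 1) * ?B powr (e - 1))"
      by (simp add: algebra_simps)
    also have "\<dots> = 2 * e * cos \<rho> * (?A * ?B) powr (e - 1)"
      using pos by (subst powr_mult) auto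
    finally show ?thesis by (simp only: power2_eq_square)
  qed
  ultimately have d: "(clock e has_real_derivative ?d) (at \<rho>)"
    unfolding clock_def[abs_def] by simp
  have "rate e (clock e \<rho>) * ?d = (?A / ?B) powr M"
    unfolding clock_def using rate_clock_deriv[OF pos(1,2) _ pos(3) c2 e e0] by simp
  \<comment> \<open>Exchanging 1 + sin and 1 - sin replaces \<open>clock e\<close> by its complement
    and leaves \<open>?d\<close> unchanged.\<close>
  moreover have "rate e (1 - clock e \<rho>) * ?d = (?B / ?A) powr M"
  proof -
    have "1 - clock e \<rho> = ?B powr e / (?B powr e + ?A powr e)"
      unfolding clock_def using S by (simp add: field_simps)
    then show ?thesis
      using rate_clock_deriv[OF pos(2,1) _ pos(3) _ e e0] c2 by (simp add: mult.commute add.commute)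
  qed
  ultimately show thesis
    using that[OF d] pos by (simp add: sigma_powr[OF \<rho>] powr_divide powr_minus_divide)
qed

text \<open>The logarithmic derivative of sigma is -1 / cos, so its powers \<open>M\<close> and
  \<open>-M\<close> are integrating factors that absorb the mass terms of the Dirac
  operator.\<close>

lemma sigma_powr_deriv:
  assumes \<rho>: "\<rho> \<in> {- (pi / 2)<..<pi / 2}"
  shows "((\<lambda>\<rho>. sigma_fn \<rho> powr m) has_real_derivative - (m / cos \<rho>) * sigma_fn \<rho> powr m) (at \<rho>)"
proof -
  let ?A = "1 + sin \<rho>" and ?B = "1 - sin \<rho>"
  note pos = one_plus_minus_sin_pos[OF \<rho>]
  have c2: "cos \<rho> * cos \<rho> = ?A * ?B"
    using sin_cos_squared_add[of \<rho>] by (simp add: algebra_simps power2_eq_square)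
  have "((\<lambda>\<rho>. (1 - sin \<rho>) powr (m / 2) * (1 + sin \<rho>) powr (- m / 2)) has_real_derivative
      ?B powr (m / 2) * (- m / 2 * ?A powr (- m / 2 - 1) * cos \<rho>)
      + m / 2 * ?B powr (m / 2 - 1) * - cos \<rho> * ?A powr (- m / 2)) (at \<rho>)"
    using pos by (auto intro!: derivative_eq_intros)
  also have "?B powr (m / 2) * (- m / 2 * ?A powr (- m / 2 - 1) * cos \<rho>)
      + m / 2 * ?B powr (m / 2 - 1) * - cos \<rho> * ?A powr (- m / 2)
      = - (m / cos \<rho>) * sigma_fn \<rho> powr m"
  proof -
    have A: "?A powr (- m / 2 - 1) = ?A powr (- m / 2) / ?A" and B: "?B powr (m / 2 - 1) = ?B powr (m / 2) / ?B"
      using pos by (simp_all add: powr_diff)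
    have "c / A + c / B = 2 / c" if "0 < A" "0 < B" "A + B = 2" "c * c = A * B" for c A B :: real
    proof -
      have "c / A + c / B = c * (A + B) / (A * B)" using that(1,2) by (simp add: field_simps)
      then show ?thesis unfolding that(3) that(4)[symmetric] by simp
    qed
    from this[OF pos(1,2) _ c2] have "2 / cos \<rho> = cos \<rho> / ?A + cos \<rho> / ?B" by simp
    moreover have "m / cos \<rho> = m / 2 * (2 / cos \<rho>)" by simp
    ultimately have "m / cos \<rho> = m / 2 * (cos \<rho> / ?A) + m / 2 * (cos \<rho> / ?B)" by (simp only: distrib_left)
    then show ?thesis unfolding A B sigma_powr(1)[OF \<rho>] by (simp add: algebra_simps)
  qed
  finally show ?thesis
    by (rule has_field_derivative_transform_within_open[where S = "{- (pi / 2)<..<pi / 2}"])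
      (use \<rho> sigma_powr(1) in auto)
qed

lemma has_vector_derivative_vector_2:
  fixes f g :: "real \<Rightarrow> complex"
  assumes "(f has_vector_derivative f') F" "(g has_vector_derivative g') F"
  shows "((\<lambda>x. vector [f x, g x] :: complex^2) has_vector_derivative vector [f', g']) F"
proof -
  have lin: "bounded_linear (\<lambda>z. vector [z, 0] :: complex^2)" "bounded_linear (\<lambda>z. vector [0, z] :: complex^2)"
    unfolding linear_conv_bounded_linear[symmetric]
    by (auto intro!: linearI simp: vec_eq_iff forall_2)
  have split: "vector [a, b] = (vector [a, 0] + vector [0, b] :: complex^2)" for a b
    by (simp add: vec_eq_iff forall_2)
  show ?thesis
    by (subst (1 2) split)
      (intro has_vector_derivative_add lin[THEN bounded_linear.has_vector_derivative] assms)
qed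

lemma eventually_interior:
  "eventually (\<lambda>\<rho>. \<rho> \<in> {- (pi / 2)<..<pi / 2}) (at_left (pi / 2))"
  "eventually (\<lambda>\<rho>. \<rho> \<in> {- (pi / 2)<..<pi / 2}) (at_right (- (pi / 2)))"
proof -
  have "- (pi / 2) < pi / 2" using pi_gt_zero by linarith
  then show "eventually (\<lambda>\<rho>. \<rho> \<in> {- (pi / 2)<..<pi / 2}) (at_left (pi / 2))"
    "eventually (\<lambda>\<rho>. \<rho> \<in> {- (pi / 2)<..<pi / 2}) (at_right (- (pi / 2)))"
    by (rule eventually_at_left_real, rule eventually_at_right_real)
qed

lemma clock_tendsto:
  assumes "0 < e"
  shows "(clock e \<longlongrightarrow> 1) (at_left (pi / 2))" "(clock e \<longlongrightarrow> 0) (at_right (- (pi / 2)))"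
proof -
  \<comment> \<open>At an end point one of the two bases is 0. Since \<open>e\<close> is positive
    and both bases are nonnegative, the powers remain continuous there.\<close>
  have "(clock e \<longlongrightarrow> (1 + sin \<rho>) powr e / ((1 + sin \<rho>) powr e + (1 - sin \<rho>) powr e)) (at \<rho> within S)"
    if "sin \<rho> = 1 \<or> sin \<rho> = -1" for \<rho> S
  proof -
    have "0 \<le> 1 + sin x" "0 \<le> 1 - sin x" for x :: real
      using sin_ge_minus_one[of x] sin_le_one[of x] by linarith+
    then show ?thesis
      unfolding clock_def[abs_def] using that assms
      by (intro tendsto_intros tendsto_powr') auto
  qed
  from this[of "pi / 2" "{..<pi / 2}"] this[of "- (pi / 2)" "{- (pi / 2)<..}"]
  show "(clock e \<longlongrightarrow> 1) (at_left (pi / 2))" "(clock e \<longlongrightarrow> 0) (at_right (- (pi / 2)))"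
    by simp_all
qed

section \<open>From a unitary matrix to an eigenfunction satisfying its boundary condition\<close>

lemma unitary_2x2_entries:
  fixes U :: "complex^2^2"
  assumes "unitary_matrix U"
  obtains \<eta> where "U$2$2 = \<eta>\<^sup>2 * cnj (U$1$1)" "U$2$1 = - (\<eta>\<^sup>2 * cnj (U$1$2))" "\<eta> * cnj \<eta> = 1"
    "U$1$1 * cnj (U$1$1) + U$1$2 * cnj (U$1$2) = 1"
proof -
  let ?A = "U$1$1" and ?B = "U$1$2" and ?C = "U$2$1" and ?D = "U$2$2"
  have "U ** hermitian_adjoint U = mat 1" using assms by (simp add: unitary_matrix_def)
  then have E: "?A * cnj ?A + ?B * cnj ?B = 1" "?A * cnj ?C + ?B * cnj ?D = 0"
    "?C * cnj ?A + ?D * cnj ?B = 0" "?C * cnj ?C + ?D * cnj ?D = 1"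
    by (simp_all add: vec_eq_iff forall_2 matrix_matrix_mult_def hermitian_adjoint_def mat_def sum_2)
  define \<delta> where "\<delta> = ?A * ?D - ?B * ?C"
  \<comment> \<open>A square root of the determinant is the phase that makes the boundary
    determinant real; it inherits modulus 1.\<close>
  define \<eta> where "\<eta> = csqrt \<delta>"
  have \<eta>: "\<eta>\<^sup>2 = \<delta>" unfolding \<eta>_def by simp
  have "\<delta> * cnj \<delta> = 1" unfolding \<delta>_def complex_cnj_diff complex_cnj_mult using E by algebra
  then have "complex_of_real ((cmod \<delta>)\<^sup>2) = 1" by (simp only: complex_norm_square)
  then have "(cmod \<delta>)\<^sup>2 = 1" by (simp only: of_real_eq_1_iff)
  then have "cmod \<delta> = 1" using norm_ge_zero[of \<delta>] by (simp add: power2_eq_1_iff)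
  then have "cmod \<eta> = 1" unfolding \<eta>_def by simp
  then have "\<eta> * cnj \<eta> = 1" by (simp flip: complex_norm_square)
  \<comment> \<open>The inverse is the adjoint, so Cramer's rule expresses the second row by the
    first row and the determinant.\<close>
  moreover have "?D = \<eta>\<^sup>2 * cnj ?A" "?C = - (\<eta>\<^sup>2 * cnj ?B)"
    unfolding \<eta> \<delta>_def using E by algebra+
  ultimately show thesis using that E(1) by blast
qed

lemma eigenfunction_exists:
  fixes U :: "complex^2^2"
  assumes M: "0 \<le> M" "M < 1/2" and U: "unitary_matrix U"
  obtains \<omega> \<Phi> x y a b where "1 \<le> \<omega>" "is_solution M \<omega> \<Phi>"
    "(tilde1 M \<Phi> \<longlongrightarrow> x) (at_left (pi / 2))" "(tilde1 M \<Phi> \<longlongrightarrow> y) (at_right (- (pi / 2)))"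
    "(tilde2 M \<Phi> \<longlongrightarrow> a) (at_left (pi / 2))" "(tilde2 M \<Phi> \<longlongrightarrow> b) (at_right (- (pi / 2)))"
    "y \<noteq> 0 \<or> b \<noteq> 0" "x \<noteq> 0 \<or> a \<noteq> 0"
    "(1 - U$1$1) * a - U$1$2 * b = \<i> * ((1 + U$1$1) * x - U$1$2 * y)"
    "- U$2$1 * a + (1 - U$2$2) * b = \<i> * (U$2$1 * x - (1 + U$2$2) * y)"
proof -
  define e where "e = (1 - 2 * M) / 4"
  have e: "0 < e" "e \<le> 1/4" unfolding e_def using M by simp_all
  interpret planar_system "rate e" "\<lambda>t. rate e (1 - t)" by (rule planar_system_rate[OF e])
  obtain \<eta> where "U$2$2 = \<eta>\<^sup>2 * cnj (U$1$1)" "U$2$1 = - (\<eta>\<^sup>2 * cnj (U$1$2))" "\<eta> * cnj \<eta> = 1"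
    "U$1$1 * cnj (U$1$1) + U$1$2 * cnj (U$1$2) = 1" using unitary_2x2_entries[OF U] .
  note \<eta> = this
  obtain w X Y and y b x a :: complex where w: "1 \<le> w" and X: "solution w X" and Y: "solution w Y"
    and nz: "y \<noteq> 0 \<or> b \<noteq> 0" "x \<noteq> 0 \<or> a \<noteq> 0"
    and XY0: "X 0 = 1" "Y 0 = \<i>" and x: "x = y * Re (X 1) + b * Re (Y 1)" and a: "a = y * Im (X 1) + b * Im (Y 1)"
    and bc: "(1 - U$1$1) * a - U$1$2 * b = \<i> * ((1 + U$1$1) * x - U$1$2 * y)"
    "- U$2$1 * a + (1 - U$2$2) * b = \<i> * (U$2$1 * x - (1 + U$2$2) * y)"
    by (rule unitary_boundary_eigenvalue[OF \<eta>])
  \<comment> \<open>\<open>X\<close> and \<open>Y\<close> encode real solutions as complex numbers,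
    so the complex coefficients \<open>y\<close> and \<open>b\<close> have to be applied to real and
    imaginary parts separately.\<close>
  define F where "F t = y * of_real (Re (X t)) + b * of_real (Re (Y t))" for t
  define G where "G t = y * of_real (Im (X t)) + b * of_real (Im (Y t))" for t
  have F0: "F 0 = y" "G 0 = b" "F 1 = x" "G 1 = a" by (simp_all add: F_def G_def XY0 x a)
  have contFG: "continuous_on {0..1} F" "continuous_on {0..1} G"
    unfolding F_def G_def by (intro continuous_intros solution_continuous[OF X] solution_continuous[OF Y])+
  have dFG: "(F has_vector_derivative of_real (w * rate e t) * G t) (at t)"
    "(G has_vector_derivative - (of_real (w * rate e (1 - t)) * F t)) (at t)" if t: "t \<in> {0<..<1}" for t
  proof -
    have d: "((\<lambda>t. complex_of_real (Re (Z t))) has_vector_derivative of_real (w * (rate e t * Im (Z t)))) (at t)"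
      "((\<lambda>t. complex_of_real (Im (Z t))) has_vector_derivative of_real (- (w * (rate e (1 - t) * Re (Z t))))) (at t)"
      if Z: "solution w Z" for Z
    proof -
      have "(Z has_vector_derivative w *\<^sub>R vector_field t (Z t)) (at t within {0..1})"
        using Z t unfolding solution_def by auto
      then have "(Z has_vector_derivative w *\<^sub>R vector_field t (Z t)) (at t)"
        using t by (simp add: at_within_Icc_at)
      from bounded_linear.has_vector_derivative[OF bounded_linear_of_real bounded_linear.has_vector_derivative[OF bounded_linear_Re this]]
        bounded_linear.has_vector_derivative[OF bounded_linear_of_real bounded_linear.has_vector_derivative[OF bounded_linear_Im this]]
      show "((\<lambda>t. complex_of_real (Re (Z t))) has_vector_derivative of_real (w * (rate e t * Im (Z t)))) (at t)"
        "((\<lambda>t. complex_of_real (Im (Z t))) has_vector_derivative of_real (- (w * (rate e (1 - t) * Re (Z t))))) (at t)"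
        by (simp_all add: vector_field_def)
    qed
    show "(F has_vector_derivative of_real (w * rate e t) * G t) (at t)"
      unfolding F_def[abs_def] G_def
      by (rule has_vector_derivative_eq_rhs[OF has_vector_derivative_add[OF
            has_vector_derivative_mult_right[OF d(1)[OF X]] has_vector_derivative_mult_right[OF d(1)[OF Y]]]])
        (simp add: algebra_simps)
    show "(G has_vector_derivative - (of_real (w * rate e (1 - t)) * F t)) (at t)"
      unfolding F_def G_def[abs_def]
      by (rule has_vector_derivative_eq_rhs[OF has_vector_derivative_add[OF
            has_vector_derivative_mult_right[OF d(2)[OF X]] has_vector_derivative_mult_right[OF d(2)[OF Y]]]])
        (simp add: algebra_simps)
  qed
  define f where "f \<rho> = F (clock e \<rho>)" for \<rho>
  define g where "g \<rho> = G (clock e \<rho>)" for \<rho>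
  \<comment> \<open>The powers of sigma undo the tildes, and differentiating them produces the terms
    with \<open>M / cos \<rho>\<close>.\<close>
  define \<Phi> :: "real \<Rightarrow> complex^2" where
    "\<Phi> \<rho> = vector [of_real (sigma_fn \<rho> powr M) * f \<rho>, of_real (sigma_fn \<rho> powr (- M)) * g \<rho>]" for \<rho>
  have sol: "is_solution M w \<Phi>"
    unfolding is_solution_def
  proof
    fix \<rho> assume \<rho>: "\<rho> \<in> {- (pi / 2)<..<pi / 2}"
    let ?s = "sigma_fn \<rho>"
    have s0: "0 < ?s" using one_plus_minus_sin_pos[OF \<rho>] by (simp add: sigma_fn_def)
    obtain d where d: "(clock e has_real_derivative d) (at \<rho>)"
      "rate e (clock e \<rho>) * d = ?s powr (- 2 * M)" "rate e (1 - clock e \<rho>) * d = ?s powr (2 * M)"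
      using clock_deriv[OF \<rho> M(2) e_def M(1)] .
    have d': "(clock e has_vector_derivative d) (at \<rho>)"
      using d(1) by (simp add: has_real_derivative_iff_has_vector_derivative)
    have "(f has_vector_derivative d *\<^sub>R (of_real (w * rate e (clock e \<rho>)) * G (clock e \<rho>))) (at \<rho>)"
      using vector_diff_chain_at[OF d' dFG(1)[OF clock_in_unit[OF \<rho>]]] by (simp add: o_def f_def[abs_def])
    also have "d *\<^sub>R (of_real (w * rate e (clock e \<rho>)) * G (clock e \<rho>))
        = of_real (w * (rate e (clock e \<rho>) * d)) * g \<rho>"
      by (simp add: g_def scaleR_conv_of_real)
    finally have df: "(f has_vector_derivative of_real (w * ?s powr (- 2 * M)) * g \<rho>) (at \<rho>)"
      unfolding d(2) .
    have "(g has_vector_derivative d *\<^sub>R - (of_real (w * rate e (1 - clock e \<rho>)) * F (clock e \<rho>))) (at \<rho>)"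
      using vector_diff_chain_at[OF d' dFG(2)[OF clock_in_unit[OF \<rho>]]] by (simp add: o_def g_def[abs_def])
    also have "d *\<^sub>R - (of_real (w * rate e (1 - clock e \<rho>)) * F (clock e \<rho>))
        = - of_real (w * (rate e (1 - clock e \<rho>) * d)) * f \<rho>"
      by (simp add: f_def scaleR_conv_of_real)
    finally have dg: "(g has_vector_derivative - of_real (w * ?s powr (2 * M)) * f \<rho>) (at \<rho>)"
      unfolding d(3) .
    have ds: "((\<lambda>\<rho>. complex_of_real (sigma_fn \<rho> powr m)) has_vector_derivative
        of_real (- (m / cos \<rho>) * ?s powr m)) (at \<rho>)" for m
      by (intro bounded_linear.has_vector_derivative[OF bounded_linear_of_real])
        (simp only: sigma_powr_deriv[OF \<rho>] flip: has_real_derivative_iff_has_vector_derivative)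
    have p: "?s powr M * ?s powr (- 2 * M) = ?s powr (- M)" "?s powr (- M) * ?s powr (2 * M) = ?s powr M"
      by (simp_all flip: powr_add)
    have q: "of_real c1 * (of_real (w * c2) * z) = of_real (w * (c1 * c2)) * z" for c1 c2 and z :: complex
      by simp
    have p': "of_real (?s powr M) * (of_real (w * ?s powr (- 2 * M)) * z) = of_real (w * ?s powr (- M)) * z"
      "of_real (?s powr (- M)) * (of_real (w * ?s powr (2 * M)) * z) = of_real (w * ?s powr M) * z" for z :: complex
      by (simp_all only: q p)
    have d\<Phi>: "(\<Phi> has_vector_derivative vector
        [of_real (- (M / cos \<rho>)) * \<Phi> \<rho> $ 1 + of_real w * \<Phi> \<rho> $ 2,
         of_real (M / cos \<rho>) * \<Phi> \<rho> $ 2 - of_real w * \<Phi> \<rho> $ 1]) (at \<rho>)"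
      unfolding \<Phi>_def[abs_def] vector_2
    proof (rule has_vector_derivative_vector_2)
      show "((\<lambda>\<rho>. of_real (sigma_fn \<rho> powr M) * f \<rho>) has_vector_derivative
         of_real (- (M / cos \<rho>)) * (of_real (?s powr M) * f \<rho>) + of_real w * (of_real (?s powr - M) * g \<rho>)) (at \<rho>)"
        by (rule has_vector_derivative_eq_rhs[OF has_vector_derivative_mult[OF ds df]])
          (simp only: p', simp)
      show "((\<lambda>\<rho>. of_real (sigma_fn \<rho> powr - M) * g \<rho>) has_vector_derivative
         of_real (M / cos \<rho>) * (of_real (?s powr - M) * g \<rho>) - of_real w * (of_real (?s powr M) * f \<rho>)) (at \<rho>)"
        by (rule has_vector_derivative_eq_rhs[OF has_vector_derivative_mult[OF ds dg]])
          (simp only: p' mult_minus_left mult_minus_right, simp)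
    qed
    have "\<Phi> differentiable at \<rho>" using d\<Phi> by (rule differentiableI_vector)
    moreover have "dirac_op M \<Phi> \<rho> = w *\<^sub>R \<Phi> \<rho>"
      unfolding dirac_op_def vector_derivative_at[OF d\<Phi>]
      by (simp only: vec_eq_iff forall_2 vector_2 vector_scaleR_component) (simp add: scaleR_conv_of_real)
    ultimately show "\<Phi> differentiable at \<rho> \<and> dirac_op M \<Phi> \<rho> = w *\<^sub>R \<Phi> \<rho>" ..
  qed
  have tilde: "tilde1 M \<Phi> \<rho> = f \<rho>" "tilde2 M \<Phi> \<rho> = g \<rho>" if \<rho>: "\<rho> \<in> {- (pi / 2)<..<pi / 2}" for \<rho>
  proof -
    have "0 < sigma_fn \<rho>" using one_plus_minus_sin_pos[OF \<rho>] by (simp add: sigma_fn_def)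
    then have p: "of_real (sigma_fn \<rho> powr M) * (of_real (sigma_fn \<rho> powr (- M)) * z) = z"
      "of_real (sigma_fn \<rho> powr (- M)) * (of_real (sigma_fn \<rho> powr M) * z) = z" for z :: complex
      by (simp_all add: powr_minus)
    show "tilde1 M \<Phi> \<rho> = f \<rho>" "tilde2 M \<Phi> \<rho> = g \<rho>"
      unfolding tilde1_def tilde2_def \<Phi>_def vector_2 scaleR_conv_of_real p by simp_all
  qed
  have lim: "(h \<longlongrightarrow> H l) K"
    if ev: "eventually (\<lambda>\<rho>. \<rho> \<in> {- (pi / 2)<..<pi / 2}) K" and l: "(clock e \<longlongrightarrow> l) K" "l \<in> {0..1}"
      and H: "continuous_on {0..1} H" and h: "\<And>\<rho>. \<rho> \<in> {- (pi / 2)<..<pi / 2} \<Longrightarrow> h \<rho> = H (clock e \<rho>)"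
    for h H :: "real \<Rightarrow> complex" and l K
  proof -
    have "eventually (\<lambda>\<rho>. clock e \<rho> \<in> {0..1}) K"
      by (rule eventually_mono[OF ev]) (use clock_in_unit[of _ e] in \<open>simp add: less_imp_le\<close>)
    then have "((\<lambda>\<rho>. H (clock e \<rho>)) \<longlongrightarrow> H l) K"
      by (rule continuous_on_tendsto_compose[OF H l])
    moreover have "eventually (\<lambda>\<rho>. H (clock e \<rho>) = h \<rho>) K"
      by (rule eventually_mono[OF ev]) (simp only: h)
    ultimately show ?thesis by (rule Lim_transform_eventually)
  qed
  show thesis
  proof (rule that[OF w sol _ _ _ _ nz bc])
    show "(tilde1 M \<Phi> \<longlongrightarrow> x) (at_left (pi / 2))" "(tilde2 M \<Phi> \<longlongrightarrow> a) (at_left (pi / 2))"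
      unfolding F0(3,4)[symmetric]
      by (rule lim[OF eventually_interior(1) clock_tendsto(1)[OF e(1)]];
          simp add: contFG tilde f_def g_def del: greaterThanLessThan_iff)+
    show "(tilde1 M \<Phi> \<longlongrightarrow> y) (at_right (- (pi / 2)))" "(tilde2 M \<Phi> \<longlongrightarrow> b) (at_right (- (pi / 2)))"
      unfolding F0(1,2)[symmetric]
      by (rule lim[OF eventually_interior(2) clock_tendsto(2)[OF e(1)]];
          simp add: contFG tilde f_def g_def del: greaterThanLessThan_iff)+
  qed
qed

section \<open>Boundary values and ladder operators\<close>

text \<open>Since cos^2 = (1 - sin)(1 + sin), the product has exponents 1/2 + m and 1/2 - m in these
  factors, both positive. It is the weight of the terms by which a ladder operator mixes the two
  components.\<close>

lemma cos_sigma_powr_tendsto_0: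
  assumes "\<bar>m\<bar> < 1/2"
  shows "((\<lambda>\<rho>. cos \<rho> * sigma_fn \<rho> powr (2 * m)) \<longlongrightarrow> 0) (at_left (pi / 2))"
    "((\<lambda>\<rho>. cos \<rho> * sigma_fn \<rho> powr (2 * m)) \<longlongrightarrow> 0) (at_right (- (pi / 2)))"
proof -
  have eq: "cos \<rho> * sigma_fn \<rho> powr (2 * m) = (1 - sin \<rho>) powr (1/2 + m) * (1 + sin \<rho>) powr (1/2 - m)"
    if \<rho>: "\<rho> \<in> {- (pi / 2)<..<pi / 2}" for \<rho>
  proof -
    note pos = one_plus_minus_sin_pos[OF \<rho>]
    have "(cos \<rho>)\<^sup>2 = (1 - sin \<rho>) * (1 + sin \<rho>)"
      by (simp add: cos_squared_eq algebra_simps power2_eq_square)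
    then have "cos \<rho> = sqrt ((1 - sin \<rho>) * (1 + sin \<rho>))"
      using real_sqrt_unique pos(3) by fastforce
    then have "cos \<rho> = (1 - sin \<rho>) powr (1/2) * (1 + sin \<rho>) powr (1/2)"
      using pos by (simp add: powr_half_sqrt real_sqrt_mult)
    then have "cos \<rho> * sigma_fn \<rho> powr (2 * m)
        = ((1 - sin \<rho>) powr (1/2) * (1 - sin \<rho>) powr m) * ((1 + sin \<rho>) powr (1/2) * (1 + sin \<rho>) powr (- m))"
      unfolding sigma_powr(1)[OF \<rho>] by simp
    then show ?thesis by (simp flip: powr_add)
  qed
  have "((\<lambda>\<rho>. (1 - sin \<rho>) powr (1/2 + m) * (1 + sin \<rho>) powr (1/2 - m)) \<longlongrightarrow>
      (1 - sin \<rho>0) powr (1/2 + m) * (1 + sin \<rho>0) powr (1/2 - m)) (at \<rho>0 within S)" for \<rho>0 S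
  proof -
    have "0 \<le> 1 + sin x" "0 \<le> 1 - sin x" for x :: real
      using sin_ge_minus_one[of x] sin_le_one[of x] by linarith+
    then show ?thesis using assms by (intro tendsto_intros tendsto_powr') auto
  qed
  from this[of "pi / 2" "{..<pi / 2}"] this[of "- (pi / 2)" "{- (pi / 2)<..}"]
  have lim: "((\<lambda>\<rho>. (1 - sin \<rho>) powr (1/2 + m) * (1 + sin \<rho>) powr (1/2 - m)) \<longlongrightarrow> 0) (at_left (pi / 2))"
    "((\<lambda>\<rho>. (1 - sin \<rho>) powr (1/2 + m) * (1 + sin \<rho>) powr (1/2 - m)) \<longlongrightarrow> 0) (at_right (- (pi / 2)))"
    by simp_all
  show "((\<lambda>\<rho>. cos \<rho> * sigma_fn \<rho> powr (2 * m)) \<longlongrightarrow> 0) (at_left (pi / 2))"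
    by (rule Lim_transform_eventually[OF lim(1)])
      (rule eventually_mono[OF eventually_interior(1)], simp only: eq)
  show "((\<lambda>\<rho>. cos \<rho> * sigma_fn \<rho> powr (2 * m)) \<longlongrightarrow> 0) (at_right (- (pi / 2)))"
    by (rule Lim_transform_eventually[OF lim(2)])
      (rule eventually_mono[OF eventually_interior(2)], simp only: eq)
qed

text \<open>\<open>x\<close>, \<open>a\<close> are the values at the right end point and \<open>y\<close>, \<open>b\<close> those at the left one.\<close>

definition boundary_limits :: "real \<Rightarrow> (real \<Rightarrow> complex^2) \<Rightarrow> complex \<Rightarrow> complex \<Rightarrow> complex \<Rightarrow> complex \<Rightarrow> bool" where
  "boundary_limits M \<Phi> x y a b \<longleftrightarrow>
     (tilde1 M \<Phi> \<longlongrightarrow> x) (at_left (pi / 2)) \<and> (tilde1 M \<Phi> \<longlongrightarrow> y) (at_right (- (pi / 2))) \<and>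
     (tilde2 M \<Phi> \<longlongrightarrow> a) (at_left (pi / 2)) \<and> (tilde2 M \<Phi> \<longlongrightarrow> b) (at_right (- (pi / 2)))"

definition boundary_equations :: "complex^2^2 \<Rightarrow> complex \<Rightarrow> complex \<Rightarrow> complex \<Rightarrow> complex \<Rightarrow> bool" where
  "boundary_equations U x y a b \<longleftrightarrow>
     (1 - U$1$1) * a - U$1$2 * b = \<i> * ((1 + U$1$1) * x - U$1$2 * y) \<and>
     - U$2$1 * a + (1 - U$2$2) * b = \<i> * (U$2$1 * x - (1 + U$2$2) * y)"

lemma has_boundary_values_iff: "has_boundary_values M \<Phi> \<longleftrightarrow> (\<exists>x y a b. boundary_limits M \<Phi> x y a b)"
  unfolding has_boundary_values_def boundary_limits_def by blast

lemma boundary_limits_values: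
  assumes "boundary_limits M \<Phi> x y a b"
  shows "right_value (tilde1 M \<Phi>) = x" "left_value (tilde1 M \<Phi>) = y"
    "right_value (tilde2 M \<Phi>) = a" "left_value (tilde2 M \<Phi>) = b"
  using assms tendsto_Lim[OF trivial_limit_at_left_real[of "pi / 2"]]
    tendsto_Lim[OF trivial_limit_at_right_real[of "- (pi / 2)"]]
  unfolding boundary_limits_def right_value_def left_value_def by blast+

lemma satisfies_BC_iff:
  assumes "boundary_limits M \<Phi> x y a b"
  shows "satisfies_BC M U \<Phi> \<longleftrightarrow> boundary_equations U x y a b"
proof -
  have "has_boundary_values M \<Phi>" using assms has_boundary_values_iff by blast
  then show ?thesis
    unfolding satisfies_BC_def boundary_limits_values[OF assms] boundary_equations_def
    by (simp add: vec_eq_iff forall_2 matrix_vector_mult_def sum_2 mat_def)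
qed

text \<open>\<open>\<mu>\<close> and \<open>\<kappa>\<close> are free so that both ladder operators
  are instances. In the tilde variables the mixing terms carry cos times a power of sigma and vanish
  in the limit; the values 1 and -1 of sin then give the four scalars.\<close>

lemma ladder_boundary_limits:
  fixes \<Phi> \<Psi> :: "real \<Rightarrow> complex^2"
  assumes M: "0 \<le> M" "M < 1/2" and lim: "boundary_limits M \<Phi> x y a b"
    and \<Psi>: "\<And>\<rho>. \<rho> \<in> {- (pi / 2)<..<pi / 2} \<Longrightarrow>
      \<Psi> \<rho> $ 1 = of_real (- M - \<mu> * sin \<rho>) * \<Phi> \<rho> $ 1 + of_real (\<kappa> * cos \<rho>) * \<Phi> \<rho> $ 2 \<and>
      \<Psi> \<rho> $ 2 = of_real (M - \<mu> * sin \<rho>) * \<Phi> \<rho> $ 2 - of_real (\<kappa> * cos \<rho>) * \<Phi> \<rho> $ 1"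
  shows "boundary_limits M \<Psi> (of_real (- M - \<mu>) * x) (of_real (- M + \<mu>) * y)
    (of_real (M - \<mu>) * a) (of_real (M + \<mu>) * b)"
proof -
  let ?c = "\<lambda>m \<rho>. cos \<rho> * sigma_fn \<rho> powr (2 * m)"
  have eq: "tilde1 M \<Psi> \<rho> = of_real (- M - \<mu> * sin \<rho>) * tilde1 M \<Phi> \<rho> + of_real (\<kappa> * ?c (- M) \<rho>) * tilde2 M \<Phi> \<rho>"
    "tilde2 M \<Psi> \<rho> = of_real (M - \<mu> * sin \<rho>) * tilde2 M \<Phi> \<rho> - of_real (\<kappa> * ?c M \<rho>) * tilde1 M \<Phi> \<rho>"
    if \<rho>: "\<rho> \<in> {- (pi / 2)<..<pi / 2}" for \<rho>
  proof -
    let ?s = "sigma_fn \<rho>"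
    have p: "?s powr (- M) = ?s powr (2 * (- M)) * ?s powr M" "?s powr M = ?s powr (2 * M) * ?s powr (- M)"
      by (simp_all flip: powr_add)
    show "tilde1 M \<Psi> \<rho> = of_real (- M - \<mu> * sin \<rho>) * tilde1 M \<Phi> \<rho> + of_real (\<kappa> * ?c (- M) \<rho>) * tilde2 M \<Phi> \<rho>"
      unfolding tilde1_def tilde2_def conjunct1[OF \<Psi>[OF \<rho>]]
      by (simp only: scaleR_conv_of_real distrib_left of_real_mult arg_cong[OF p(1), of complex_of_real])
        (simp add: arg_cong[OF p(1), of complex_of_real] algebra_simps)
    show "tilde2 M \<Psi> \<rho> = of_real (M - \<mu> * sin \<rho>) * tilde2 M \<Phi> \<rho> - of_real (\<kappa> * ?c M \<rho>) * tilde1 M \<Phi> \<rho>"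
      unfolding tilde1_def tilde2_def conjunct2[OF \<Psi>[OF \<rho>]]
      by (simp add: scaleR_conv_of_real arg_cong[OF p(2), of complex_of_real] algebra_simps)
  qed
  have limits: "(tilde1 M \<Psi> \<longlongrightarrow> of_real (- M - \<mu> * sin l) * p) (at l within S)"
    "(tilde2 M \<Psi> \<longlongrightarrow> of_real (M - \<mu> * sin l) * q) (at l within S)"
    if "(tilde1 M \<Phi> \<longlongrightarrow> p) (at l within S)" "(tilde2 M \<Phi> \<longlongrightarrow> q) (at l within S)"
      and c: "\<And>m. \<bar>m\<bar> < 1/2 \<Longrightarrow> (?c m \<longlongrightarrow> 0) (at l within S)"
      and ev: "eventually (\<lambda>\<rho>. \<rho> \<in> {- (pi / 2)<..<pi / 2}) (at l within S)" for l S p q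
  proof -
    have "((\<lambda>\<rho>. of_real (- M - \<mu> * sin \<rho>) * tilde1 M \<Phi> \<rho> + of_real (\<kappa> * ?c (- M) \<rho>) * tilde2 M \<Phi> \<rho>)
        \<longlongrightarrow> of_real (- M - \<mu> * sin l) * p + of_real (\<kappa> * 0) * q) (at l within S)"
      using M by (intro tendsto_intros that c) auto
    then have "((\<lambda>\<rho>. of_real (- M - \<mu> * sin \<rho>) * tilde1 M \<Phi> \<rho> + of_real (\<kappa> * ?c (- M) \<rho>) * tilde2 M \<Phi> \<rho>)
        \<longlongrightarrow> of_real (- M - \<mu> * sin l) * p) (at l within S)" by simp
    then show "(tilde1 M \<Psi> \<longlongrightarrow> of_real (- M - \<mu> * sin l) * p) (at l within S)"
      by (rule Lim_transform_eventually) (use ev in eventually_elim, simp only: eq)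
    have "((\<lambda>\<rho>. of_real (M - \<mu> * sin \<rho>) * tilde2 M \<Phi> \<rho> - of_real (\<kappa> * ?c M \<rho>) * tilde1 M \<Phi> \<rho>)
        \<longlongrightarrow> of_real (M - \<mu> * sin l) * q - of_real (\<kappa> * 0) * p) (at l within S)"
      using M by (intro tendsto_intros that c) auto
    then have "((\<lambda>\<rho>. of_real (M - \<mu> * sin \<rho>) * tilde2 M \<Phi> \<rho> - of_real (\<kappa> * ?c M \<rho>) * tilde1 M \<Phi> \<rho>)
        \<longlongrightarrow> of_real (M - \<mu> * sin l) * q) (at l within S)" by simp
    then show "(tilde2 M \<Psi> \<longlongrightarrow> of_real (M - \<mu> * sin l) * q) (at l within S)"
      by (rule Lim_transform_eventually) (use ev in eventually_elim, simp only: eq)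
  qed
  have R: "(tilde1 M \<Phi> \<longlongrightarrow> x) (at_left (pi / 2))" "(tilde2 M \<Phi> \<longlongrightarrow> a) (at_left (pi / 2))"
    and L: "(tilde1 M \<Phi> \<longlongrightarrow> y) (at_right (- (pi / 2)))" "(tilde2 M \<Phi> \<longlongrightarrow> b) (at_right (- (pi / 2)))"
    using lim unfolding boundary_limits_def by auto
  show ?thesis
    using limits[OF R cos_sigma_powr_tendsto_0(1) eventually_interior(1)]
      limits[OF L cos_sigma_powr_tendsto_0(2) eventually_interior(2)]
    unfolding boundary_limits_def by simp
qed

text \<open>Multiplying the eigenvalue equation by cos clears its singularity and replaces the
  derivative. The spin term shifts the mixing coefficient from omega to omega + 1/2 or omega - 1/2,
  that is to \<open>\<mu>\<close> for \<open>delta_plus\<close> and to \<open>-\<mu>\<close> for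
  \<open>delta_minus\<close>.\<close>

lemma delta_boundary_limits:
  assumes M: "0 \<le> M" "M < 1/2" and sol: "is_solution M \<omega> \<Phi>" and lim: "boundary_limits M \<Phi> x y a b"
  shows "boundary_limits M (delta_plus \<omega> \<Phi>) (of_real (- M - (1/2 + \<omega>)) * x) (of_real (- M + (1/2 + \<omega>)) * y)
      (of_real (M - (1/2 + \<omega>)) * a) (of_real (M + (1/2 + \<omega>)) * b)"
    and "boundary_limits M (delta_minus \<omega> \<Phi>) (of_real (- M - (1/2 - \<omega>)) * x) (of_real (- M + (1/2 - \<omega>)) * y)
      (of_real (M - (1/2 - \<omega>)) * a) (of_real (M + (1/2 - \<omega>)) * b)"
proof -
  have D: "of_real (cos \<rho>) * vector_derivative \<Phi> (at \<rho>) $ 1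
        = of_real (\<omega> * cos \<rho>) * \<Phi> \<rho> $ 2 - of_real M * \<Phi> \<rho> $ 1"
    "of_real (cos \<rho>) * vector_derivative \<Phi> (at \<rho>) $ 2
        = of_real M * \<Phi> \<rho> $ 2 - of_real (\<omega> * cos \<rho>) * \<Phi> \<rho> $ 1"
    if \<rho>: "\<rho> \<in> {- (pi / 2)<..<pi / 2}" for \<rho>
  proof -
    let ?V = "vector_derivative \<Phi> (at \<rho>)"
    have c: "complex_of_real (cos \<rho>) \<noteq> 0" using one_plus_minus_sin_pos(3)[OF \<rho>] by simp
    have "dirac_op M \<Phi> \<rho> = \<omega> *\<^sub>R \<Phi> \<rho>" using sol \<rho> unfolding is_solution_def by blast
    then have "- (?V $ 2) + of_real (M / cos \<rho>) * \<Phi> \<rho> $ 2 = of_real \<omega> * \<Phi> \<rho> $ 1"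
      "?V $ 1 + of_real (M / cos \<rho>) * \<Phi> \<rho> $ 1 = of_real \<omega> * \<Phi> \<rho> $ 2"
      unfolding dirac_op_def vec_eq_iff forall_2 vector_2 vector_scaleR_component
      by (simp_all only: scaleR_conv_of_real)
    then have V: "?V $ 2 = of_real (M / cos \<rho>) * \<Phi> \<rho> $ 2 - of_real \<omega> * \<Phi> \<rho> $ 1"
      "?V $ 1 = of_real \<omega> * \<Phi> \<rho> $ 2 - of_real (M / cos \<rho>) * \<Phi> \<rho> $ 1"
      by (simp_all add: algebra_simps)
    show "of_real (cos \<rho>) * ?V $ 1 = of_real (\<omega> * cos \<rho>) * \<Phi> \<rho> $ 2 - of_real M * \<Phi> \<rho> $ 1"
      "of_real (cos \<rho>) * ?V $ 2 = of_real M * \<Phi> \<rho> $ 2 - of_real (\<omega> * cos \<rho>) * \<Phi> \<rho> $ 1"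
      unfolding V using c by (simp_all add: algebra_simps)
  qed
  have S: "(Sigma01 *v z) $ 1 = \<i> / 2 * z $ 2" "(Sigma01 *v z) $ 2 = - \<i> / 2 * z $ 1" for z
    by (simp_all add: Sigma01_def matrix_vector_mult_def sum_2)
  show "boundary_limits M (delta_plus \<omega> \<Phi>) (of_real (- M - (1/2 + \<omega>)) * x) (of_real (- M + (1/2 + \<omega>)) * y)
      (of_real (M - (1/2 + \<omega>)) * a) (of_real (M + (1/2 + \<omega>)) * b)"
  proof (rule ladder_boundary_limits[OF M lim, where \<kappa> = "1/2 + \<omega>"])
    fix \<rho> assume \<rho>: "\<rho> \<in> {- (pi / 2)<..<pi / 2}"
    show "delta_plus \<omega> \<Phi> \<rho> $ 1 = of_real (- M - (1/2 + \<omega>) * sin \<rho>) * \<Phi> \<rho> $ 1 + of_real ((1/2 + \<omega>) * cos \<rho>) * \<Phi> \<rho> $ 2 \<and>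
      delta_plus \<omega> \<Phi> \<rho> $ 2 = of_real (M - (1/2 + \<omega>) * sin \<rho>) * \<Phi> \<rho> $ 2 - of_real ((1/2 + \<omega>) * cos \<rho>) * \<Phi> \<rho> $ 1"
      unfolding delta_plus_def vector_add_component vector_minus_component vector_scaleR_component
        vector_smult_component S
      unfolding scaleR_conv_of_real D[OF \<rho>]
      by (simp add: algebra_simps)
  qed
  show "boundary_limits M (delta_minus \<omega> \<Phi>) (of_real (- M - (1/2 - \<omega>)) * x) (of_real (- M + (1/2 - \<omega>)) * y)
      (of_real (M - (1/2 - \<omega>)) * a) (of_real (M + (1/2 - \<omega>)) * b)"
  proof (rule ladder_boundary_limits[OF M lim, where \<kappa> = "- (1/2 - \<omega>)"])
    fix \<rho> assume \<rho>: "\<rho> \<in> {- (pi / 2)<..<pi / 2}"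
    show "delta_minus \<omega> \<Phi> \<rho> $ 1 = of_real (- M - (1/2 - \<omega>) * sin \<rho>) * \<Phi> \<rho> $ 1 + of_real (- (1/2 - \<omega>) * cos \<rho>) * \<Phi> \<rho> $ 2 \<and>
      delta_minus \<omega> \<Phi> \<rho> $ 2 = of_real (M - (1/2 - \<omega>) * sin \<rho>) * \<Phi> \<rho> $ 2 - of_real (- (1/2 - \<omega>) * cos \<rho>) * \<Phi> \<rho> $ 1"
      unfolding delta_minus_def vector_add_component vector_minus_component vector_scaleR_component
        vector_smult_component S
      unfolding scaleR_conv_of_real D[OF \<rho>]
      by (simp add: algebra_simps)
  qed
qed

section \<open>Invariance as linear algebra of the four boundary values\<close>

lemma SL2_invariantI:
  assumes M: "0 \<le> M" "M < 1/2"
    and inv: "\<And>x y a b \<mu>. boundary_equations U x y a b \<Longrightarrow>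
      boundary_equations U (of_real (- M - \<mu>) * x) (of_real (- M + \<mu>) * y)
        (of_real (M - \<mu>) * a) (of_real (M + \<mu>) * b)"
  shows "SL2_invariant M U"
  unfolding SL2_invariant_def
proof (intro allI impI)
  fix \<omega> \<Phi> assume h: "is_solution M \<omega> \<Phi> \<and> satisfies_BC M U \<Phi>"
  then obtain x y a b where lim: "boundary_limits M \<Phi> x y a b"
    unfolding satisfies_BC_def has_boundary_values_iff by blast
  have "boundary_equations U x y a b" using h satisfies_BC_iff[OF lim] by blast
  \<comment> \<open>Here \<open>inv\<close> is applied with \<open>\<mu>\<close> equal to 1/2 +
    omega and 1/2 - omega.\<close>
  then show "satisfies_BC M U (delta_plus \<omega> \<Phi>) \<and> satisfies_BC M U (delta_minus \<omega> \<Phi>)"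
    using satisfies_BC_iff delta_boundary_limits[OF M conjunct1[OF h] lim] inv by blast
qed

text \<open>Since the eigenvalue is nonzero, the boundary conditions of the two ladder images can be solved for
  two conditions that no longer involve it.\<close>

lemma SL2_invariantD:
  assumes M: "0 \<le> M" "M < 1/2" and U: "unitary_matrix U" and inv: "SL2_invariant M U"
  obtains x y a b where "y \<noteq> 0 \<or> b \<noteq> 0" "x \<noteq> 0 \<or> a \<noteq> 0"
    "boundary_equations U x y a b" "boundary_equations U (- x) y (- a) b"
    "M \<noteq> 0 \<Longrightarrow> boundary_equations U (- x) (- y) a b"
proof -
  obtain \<omega> \<Phi> x y a b where \<omega>: "1 \<le> \<omega>" and sol: "is_solution M \<omega> \<Phi>"
    and lim: "boundary_limits M \<Phi> x y a b" and nz: "y \<noteq> 0 \<or> b \<noteq> 0" "x \<noteq> 0 \<or> a \<noteq> 0"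
    and bc: "boundary_equations U x y a b"
    using eigenfunction_exists[OF M U] unfolding boundary_limits_def boundary_equations_def by metis
  let ?E = "\<lambda>\<mu>. boundary_equations U (of_real (- M - \<mu>) * x) (of_real (- M + \<mu>) * y)
        (of_real (M - \<mu>) * a) (of_real (M + \<mu>) * b)"
  have "satisfies_BC M U \<Phi>" using bc satisfies_BC_iff[OF lim] by blast
  then have "satisfies_BC M U (delta_plus \<omega> \<Phi>)" "satisfies_BC M U (delta_minus \<omega> \<Phi>)"
    using inv sol unfolding SL2_invariant_def by blast+
  then have E: "?E (1/2 + \<omega>)" "?E (1/2 - \<omega>)"
    using satisfies_BC_iff delta_boundary_limits[OF M sol lim] by blast+
  define m l w where "m = complex_of_real M" and "l = complex_of_real (1/2)" and "w = complex_of_real \<omega>"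
  have w: "w \<noteq> 0" using \<omega> unfolding w_def by simp
  have mw: "of_real (- M - (1/2 + \<omega>)) = - m - (l + w)" "of_real (- M + (1/2 + \<omega>)) = - m + (l + w)"
    "of_real (M - (1/2 + \<omega>)) = m - (l + w)" "of_real (M + (1/2 + \<omega>)) = m + (l + w)"
    "of_real (- M - (1/2 - \<omega>)) = - m - (l - w)" "of_real (- M + (1/2 - \<omega>)) = - m + (l - w)"
    "of_real (M - (1/2 - \<omega>)) = m - (l - w)" "of_real (M + (1/2 - \<omega>)) = m + (l - w)"
    unfolding m_def l_def w_def by simp_all
  \<comment> \<open>The equations are linear, and the two ladder conditions differ by
    \<open>2 * w\<close> times this one.\<close>
  have 1: "boundary_equations U (- x) y (- a) b"
    using E w unfolding mw boundary_equations_def by algebra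
  have "boundary_equations U (- x) (- y) a b" if "M \<noteq> 0"
  proof -
    have m: "m \<noteq> 0" using that unfolding m_def by simp
    \<comment> \<open>Subtracting \<open>l + w\<close> times condition \<open>1\<close> from
      \<open>E(1)\<close> leaves \<open>m\<close> times the claim.\<close>
    show ?thesis using E(1) 1 m unfolding mw boundary_equations_def by algebra
  qed
  with nz bc 1 show thesis by (rule that)
qed

lemma boundary_equations_diagonal:
  assumes "diagonal_matrix U"
  shows "boundary_equations U x y a b \<longleftrightarrow>
    (1 - U$1$1) * a = \<i> * ((1 + U$1$1) * x) \<and> (1 - U$2$2) * b = - (\<i> * ((1 + U$2$2) * y))"
proof -
  have "U$1$2 = 0" "U$2$1 = 0" using assms unfolding diagonal_matrix_def by (metis one_neq_zero zero_neq_one exhaust_2)+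
  then show ?thesis unfolding boundary_equations_def by simp
qed

text \<open>Changing the sign of the right values only separates the two ends: a nonzero
  off-diagonal entry would force b = iy and a = -ix. Put back into the boundary condition, this
  gives y = b = 0, against the nonvanishing of the left values.\<close>

lemma SL2_invariant_imp_diagonal:
  assumes M: "0 \<le> M" "M < 1/2" and U: "unitary_matrix U" and inv: "SL2_invariant M U"
  shows "diagonal_matrix U"
proof -
  obtain x y a b where nz: "y \<noteq> 0 \<or> b \<noteq> 0" and E: "boundary_equations U x y a b" "boundary_equations U (- x) y (- a) b"
    using SL2_invariantD[OF M U inv] by metis
  have 0: "U$1$2 * (b - \<i> * y) = 0" "U$2$1 * (a + \<i> * x) = 0"
    using E unfolding boundary_equations_def by algebra+
  obtain \<eta> where "U$2$1 = - (\<eta>\<^sup>2 * cnj (U$1$2))" "\<eta> * cnj \<eta> = 1"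
    using unitary_2x2_entries[OF U] by metis
  then have iff: "U$2$1 = 0 \<longleftrightarrow> U$1$2 = 0" by auto
  have "U$1$2 = 0"
  proof (rule ccontr)
    assume "U$1$2 \<noteq> 0"
    then have b: "b = \<i> * y" and a: "a = - \<i> * x" using 0 iff by (auto simp: add_eq_0_iff)
    \<comment> \<open>All entries of \<open>U\<close> cancel from the second boundary
      equation.\<close>
    have "2 * (\<i> * y) = 0"
      using E(1) unfolding boundary_equations_def a b by (simp add: algebra_simps)
    then show False using nz b by simp
  qed
  then show ?thesis using iff unfolding diagonal_matrix_def by (simp add: forall_2)
qed

lemma diag2_nth [simp]:
  "diag2 p q $ 1 $ 1 = p" "diag2 p q $ 1 $ 2 = 0" "diag2 p q $ 2 $ 1 = 0" "diag2 p q $ 2 $ 2 = q"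
  by (simp_all add: diag2_def)

lemma diagonal_diag2: "diagonal_matrix (diag2 p q)"
  by (simp add: diagonal_matrix_def forall_2)

lemma mat_1_eq_diag2: "mat 1 = diag2 1 1" "- diag2 1 1 = diag2 (-1) (-1)"
  by (simp_all add: vec_eq_iff forall_2 mat_def)

text \<open>Changing the sign of x and y alone splits each diagonal equation into two products equal
  to 0. One value at each end is nonzero, which fixes the corresponding entry as 1 or -1.\<close>

lemma SL2_invariant_massive:
  assumes M: "0 < M" "M < 1/2" and U: "unitary_matrix U" and inv: "SL2_invariant M U"
  obtains p q where "U = diag2 p q" "p = 1 \<or> p = -1" "q = 1 \<or> q = -1"
proof -
  have M0: "0 \<le> M" using M by simp
  have diag: "diagonal_matrix U" by (rule SL2_invariant_imp_diagonal[OF M0 M(2) U inv])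
  obtain x y a b where nz: "y \<noteq> 0 \<or> b \<noteq> 0" "x \<noteq> 0 \<or> a \<noteq> 0"
    and E: "boundary_equations U x y a b" "boundary_equations U (- x) (- y) a b"
    using SL2_invariantD[OF M0 M(2) U inv] M(1) by (metis less_irrefl)
  have "(1 - U$1$1) * a = 0 \<and> (1 + U$1$1) * x = 0 \<and> (1 - U$2$2) * b = 0 \<and> (1 + U$2$2) * y = 0"
    using E unfolding boundary_equations_diagonal[OF diag] by simp blast
  moreover have n: "1 + z = 0 \<longleftrightarrow> z = -1" for z :: complex
    by (metis add.commute eq_neg_iff_add_eq_0)
  ultimately have "U$1$1 = 1 \<or> U$1$1 = -1" "U$2$2 = 1 \<or> U$2$2 = -1"
    using nz unfolding mult_eq_0_iff n by auto
  moreover have "U = diag2 (U$1$1) (U$2$2)"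
    using diag by (simp add: vec_eq_iff forall_2 diagonal_matrix_def)
  ultimately show thesis using that by blast
qed

lemma boundary_type_iff:
  assumes "has_boundary_values M \<Phi>"
  shows "satisfies_BC M (diag2 (-1) 1) \<Phi> \<longleftrightarrow> bc_type_I M \<Phi>"
    and "satisfies_BC M (diag2 1 (-1)) \<Phi> \<longleftrightarrow> bc_type_II M \<Phi>"
    and "satisfies_BC M (mat 1) \<Phi> \<longleftrightarrow> bc_type_III M \<Phi>"
    and "satisfies_BC M (- mat 1) \<Phi> \<longleftrightarrow> bc_type_IV M \<Phi>"
proof -
  obtain x y a b where lim: "boundary_limits M \<Phi> x y a b"
    using assms has_boundary_values_iff by blast
  note simps = satisfies_BC_iff[OF lim] mat_1_eq_diag2 boundary_equations_diagonal[OF diagonal_diag2]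
    bc_type_I_def bc_type_II_def bc_type_III_def bc_type_IV_def boundary_limits_values[OF lim]
  show "satisfies_BC M (diag2 (-1) 1) \<Phi> \<longleftrightarrow> bc_type_I M \<Phi>"
    and "satisfies_BC M (diag2 1 (-1)) \<Phi> \<longleftrightarrow> bc_type_II M \<Phi>"
    and "satisfies_BC M (mat 1) \<Phi> \<longleftrightarrow> bc_type_III M \<Phi>"
    and "satisfies_BC M (- mat 1) \<Phi> \<longleftrightarrow> bc_type_IV M \<Phi>"
    by (auto simp: simps)
qed

theorem mainTheorem3:
  fixes M :: real and U :: "complex^2^2"
  assumes "0 \<le> M" and "M < 1/2" and "unitary_matrix U"
  shows "(M = 0 \<longrightarrow> (SL2_invariant M U \<longleftrightarrow> diagonal_matrix U)) \<and>
    (0 < M \<longrightarrow>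
      (SL2_invariant M U \<longleftrightarrow>
         U = diag2 (-1) 1 \<or> U = diag2 1 (-1) \<or> U = mat 1 \<or> U = - mat 1) \<and>
      (\<forall>\<Phi>. has_boundary_values M \<Phi> \<longrightarrow>
         (satisfies_BC M (diag2 (-1) 1) \<Phi> \<longleftrightarrow> bc_type_I M \<Phi>) \<and>
         (satisfies_BC M (diag2 1 (-1)) \<Phi> \<longleftrightarrow> bc_type_II M \<Phi>) \<and>
         (satisfies_BC M (mat 1) \<Phi> \<longleftrightarrow> bc_type_III M \<Phi>) \<and>
         (satisfies_BC M (- mat 1) \<Phi> \<longleftrightarrow> bc_type_IV M \<Phi>)))"
proof (intro conjI impI allI boundary_type_iff)
  show "SL2_invariant M U \<longleftrightarrow> diagonal_matrix U" if M: "M = 0"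
  proof
    show "SL2_invariant M U \<Longrightarrow> diagonal_matrix U"
      by (rule SL2_invariant_imp_diagonal[OF assms])
    assume diag: "diagonal_matrix U"
    show "SL2_invariant M U"
    proof (rule SL2_invariantI[OF assms(1,2)])
      fix x y a b :: complex and \<mu> :: real
      assume "boundary_equations U x y a b"
      \<comment> \<open>For M = 0 the first equation is multiplied by \<open>-\<mu>\<close> and the
        second by \<open>\<mu>\<close>.\<close>
      then show "boundary_equations U (of_real (- M - \<mu>) * x) (of_real (- M + \<mu>) * y)
          (of_real (M - \<mu>) * a) (of_real (M + \<mu>) * b)"
        unfolding boundary_equations_diagonal[OF diag] M by (simp add: mult.left_commute)
    qed
  qed
  show "SL2_invariant M U \<longleftrightarrow>
      U = diag2 (-1) 1 \<or> U = diag2 1 (-1) \<or> U = mat 1 \<or> U = - mat 1" if M: "0 < M"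
  proof
    assume "SL2_invariant M U"
    then show "U = diag2 (-1) 1 \<or> U = diag2 1 (-1) \<or> U = mat 1 \<or> U = - mat 1"
      unfolding mat_1_eq_diag2 by (rule SL2_invariant_massive[OF M assms(2,3)]) auto
  next
    assume "U = diag2 (-1) 1 \<or> U = diag2 1 (-1) \<or> U = mat 1 \<or> U = - mat 1"
    \<comment> \<open>For these matrices the condition is the vanishing of one value at each end,
      which survives any rescaling.\<close>
    then show "SL2_invariant M U"
      by (intro SL2_invariantI[OF assms(1,2)])
        (auto simp: mat_1_eq_diag2 boundary_equations_diagonal[OF diagonal_diag2])
  qed
qed

end
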